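(* Let $R$ be a commutative Noetherian ring and $I$ a regular ideal of $R$. Let $J$ be an ideal of $R$ such that $I\subseteq J\subseteq \overline{I}$. Then there exists a finitely generated $R$-module $M$ of rank $1$ such that $I\subseteq J\subseteq r(I,M)\subseteq \overline{I}$. In particular, there exists a finitely generated $R$-module $M$ of rank $1$ such that $r(I,M)=\overline{I}$.
   Context: An ideal is regular if it contains a nonzerodivisor of $R$. $\overline{I}$ denotes the integral closure of $I$ in $R$. A finitely generated $R$-module $M$ has rank $r$ if $M\otimes_R Q$ is a free $Q$-module of rank $r$, where $Q$ is the total ring of fractions of $R$. For submodules $A,B$ of $M$, $(A:B)=\{x\in R : xB\subseteq A\}$, and $r(I,M)=\bigcup_{k\geq 1}(I^{k+1}M:I^kM)$ (an ascending union of ideals of $R$). *)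

theory Defs
  imports "HOL-Algebra.Algebra" "HOL-Algebra.Ideal_Product" "HOL-Algebra.Module"
begin

section \<open>Ideals: powers, regularity, integral closure\<close>

definition nonzerodivisors :: "('a, 'b) ring_scheme \<Rightarrow> 'a set"
  where "nonzerodivisors R =
    {s \<in> carrier R. \<forall>x \<in> carrier R. x \<otimes>\<^bsub>R\<^esub> s = \<zero>\<^bsub>R\<^esub> \<longrightarrow> x = \<zero>\<^bsub>R\<^esub>}"

definition regular_ideal :: "'a set \<Rightarrow> ('a, 'b) ring_scheme \<Rightarrow> bool"
  where "regular_ideal I R \<longleftrightarrow> ideal I R \<and> I \<inter> nonzerodivisors R \<noteq> {}"

text \<open>The power is taken in the library's monoid of ideals, so \<open>I\<^sup>0 = R\<close>.\<close>

definition ideal_pow :: "('a, 'b) ring_scheme \<Rightarrow> 'a set \<Rightarrow> nat \<Rightarrow> 'a set"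
  where "ideal_pow R I k = I [^]\<^bsub>ideals_set R\<^esub> k"

text \<open>The elements satisfying an equation
  \<open>x\<^sup>n + a\<^sub>1 x\<^sup>n\<^sup>-\<^sup>1 + \<dots> + a\<^sub>n = 0\<close> with \<open>n \<ge> 1\<close> and \<open>a\<^sub>i \<in> I\<^sup>i\<close>.\<close>

definition integral_closure :: "('a, 'b) ring_scheme \<Rightarrow> 'a set \<Rightarrow> 'a set"
  where "integral_closure R I =
    {x \<in> carrier R. \<exists>n::nat. \<exists>a. 1 \<le> n \<and> (\<forall>i \<in> {1..n}. a i \<in> ideal_pow R I i) \<and>
       x [^]\<^bsub>R\<^esub> n \<oplus>\<^bsub>R\<^esub> (\<Oplus>\<^bsub>R\<^esub>i \<in> {1..n}. a i \<otimes>\<^bsub>R\<^esub> x [^]\<^bsub>R\<^esub> (n - i)) = \<zero>\<^bsub>R\<^esub>}"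


section \<open>Submodules and the ideal \<open>r(I,M)\<close>\<close>

definition module_span ::
    "('a, 'b) ring_scheme \<Rightarrow> ('a, 'm, 'c) module_scheme \<Rightarrow> 'm set \<Rightarrow> 'm set"
  where "module_span R M A = \<Inter> {N. submodule N R M \<and> A \<subseteq> N}"

definition fin_gen_module :: "('a, 'b) ring_scheme \<Rightarrow> ('a, 'm, 'c) module_scheme \<Rightarrow> bool"
  where "fin_gen_module R M \<longleftrightarrow>
    module R M \<and> (\<exists>A \<subseteq> carrier M. finite A \<and> module_span R M A = carrier M)"

definition ideal_smult ::
    "('a, 'b) ring_scheme \<Rightarrow> ('a, 'm, 'c) module_scheme \<Rightarrow> 'a set \<Rightarrow> 'm set"
  where "ideal_smult R M I =
    module_span R M {a \<odot>\<^bsub>M\<^esub> x | a x. a \<in> I \<and> x \<in> carrier M}"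

definition colon ::
    "('a, 'b) ring_scheme \<Rightarrow> ('a, 'm, 'c) module_scheme \<Rightarrow> 'm set \<Rightarrow> 'm set \<Rightarrow> 'a set"
  where "colon R M A B = {x \<in> carrier R. \<forall>b \<in> B. x \<odot>\<^bsub>M\<^esub> b \<in> A}"

definition r_ideal ::
    "('a, 'b) ring_scheme \<Rightarrow> 'a set \<Rightarrow> ('a, 'm, 'c) module_scheme \<Rightarrow> 'a set"
  where "r_ideal R I M =
    (\<Union>k \<in> {1..}. colon R M (ideal_smult R M (ideal_pow R I (k + 1)))
                           (ideal_smult R M (ideal_pow R I k)))"


section \<open>The total ring of fractions\<close>

text \<open>The fraction \<open>a/s\<close> is the class of the pair \<open>(a, s)\<close>. Since denominators are
  nonzerodivisors, \<open>a/s = b/t\<close> means \<open>at = bs\<close>.\<close>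

definition fraction :: "('a, 'b) ring_scheme \<Rightarrow> 'a \<Rightarrow> 'a \<Rightarrow> ('a \<times> 'a) set"
  where "fraction R a s =
    {(b, t). b \<in> carrier R \<and> t \<in> nonzerodivisors R \<and> a \<otimes>\<^bsub>R\<^esub> t = b \<otimes>\<^bsub>R\<^esub> s}"

definition total_fractions :: "('a, 'b) ring_scheme \<Rightarrow> ('a \<times> 'a) set ring"
  where "total_fractions R =
    \<lparr>carrier = {fraction R a s | a s. a \<in> carrier R \<and> s \<in> nonzerodivisors R},
     monoid.mult = (\<lambda>C D. \<Union> {fraction R (a \<otimes>\<^bsub>R\<^esub> b) (s \<otimes>\<^bsub>R\<^esub> t) | a s b t. (a, s) \<in> C \<and> (b, t) \<in> D}),
     one = fraction R \<one>\<^bsub>R\<^esub> \<one>\<^bsub>R\<^esub>,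
     ring.zero = fraction R \<zero>\<^bsub>R\<^esub> \<one>\<^bsub>R\<^esub>,
     ring.add = (\<lambda>C D. 
        \<Union> {fraction R (a \<otimes>\<^bsub>R\<^esub> t \<oplus>\<^bsub>R\<^esub> b \<otimes>\<^bsub>R\<^esub> s) (s \<otimes>\<^bsub>R\<^esub> t) | a s b t. (a, s) \<in> C \<and> (b, t) \<in> D})\<rparr>"

definition to_fractions :: "('a, 'b) ring_scheme \<Rightarrow> 'a \<Rightarrow> ('a \<times> 'a) set"
  where "to_fractions R a = fraction R a \<one>\<^bsub>R\<^esub>"

context cring
begin

lemma nzd_carrier: "s \<in> nonzerodivisors R \<Longrightarrow> s \<in> carrier R"
  by (simp add: nonzerodivisors_def)

lemma nzdD: "\<lbrakk>s \<in> nonzerodivisors R; x \<in> carrier R; x \<otimes> s = \<zero>\<rbrakk> \<Longrightarrow> x = \<zero>"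
  unfolding nonzerodivisors_def by blast

lemma nzd_one [simp]: "\<one> \<in> nonzerodivisors R"
  by (simp add: nonzerodivisors_def)

lemma nzd_mult:
  assumes "s \<in> nonzerodivisors R" "t \<in> nonzerodivisors R"
  shows "s \<otimes> t \<in> nonzerodivisors R"
  unfolding nonzerodivisors_def
proof (intro CollectI conjI ballI impI)
  show "s \<otimes> t \<in> carrier R" using assms by (simp add: nzd_carrier)
  fix x assume x: "x \<in> carrier R" "x \<otimes> (s \<otimes> t) = \<zero>"
  have cl: "s \<in> carrier R" "t \<in> carrier R" using assms by (simp_all add: nzd_carrier)
  have "(x \<otimes> s) \<otimes> t = \<zero>" using x cl by (simp add: m_assoc)
  then have "x \<otimes> s = \<zero>" using nzdD[OF assms(2)] x(1) cl by simp
  then show "x = \<zero>" using nzdD[OF assms(1) x(1)] by simp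
qed

lemma nzd_cancel:
  assumes "s \<in> nonzerodivisors R" "x \<in> carrier R" "y \<in> carrier R" "x \<otimes> s = y \<otimes> s"
  shows "x = y"
proof -
  have s: "s \<in> carrier R" using assms(1) by (rule nzd_carrier)
  have "(x \<ominus> y) \<otimes> s = x \<otimes> s \<ominus> y \<otimes> s" using assms(2,3) s by algebra
  also have "\<dots> = \<zero>" using assms(3,4) s by (simp add: r_right_minus_eq)
  finally have "x \<ominus> y = \<zero>" using nzdD[OF assms(1)] assms(2,3) by simp
  then show ?thesis using assms(2,3) by (simp add: r_right_minus_eq)
qed

lemma mem_fraction_self:
  "\<lbrakk>a \<in> carrier R; s \<in> nonzerodivisors R\<rbrakk> \<Longrightarrow> (a, s) \<in> fraction R a s"
  by (simp add: fraction_def)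

lemma fraction_eq_iff:
  assumes "a \<in> carrier R" "s \<in> nonzerodivisors R" "b \<in> carrier R" "t \<in> nonzerodivisors R"
  shows "fraction R a s = fraction R b t \<longleftrightarrow> a \<otimes> t = b \<otimes> s"
proof
  assume "fraction R a s = fraction R b t"
  then have "(b, t) \<in> fraction R a s" using assms mem_fraction_self by simp
  then show "a \<otimes> t = b \<otimes> s" by (simp add: fraction_def)
next
  have *: "fraction R a s \<subseteq> fraction R b t"
    if *: "a \<in> carrier R" "s \<in> nonzerodivisors R" "b \<in> carrier R" "t \<in> nonzerodivisors R"
      "a \<otimes> t = b \<otimes> s" for a b s t
  proof clarify
    fix c u assume "(c, u) \<in> fraction R a s"
    then have c: "c \<in> carrier R" "u \<in> nonzerodivisors R" "a \<otimes> u = c \<otimes> s"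
      by (auto simp: fraction_def)
    have cl: "s \<in> carrier R" "t \<in> carrier R" "u \<in> carrier R"
      using *(2,4) c(2) nzd_carrier by auto
    have "(b \<otimes> u) \<otimes> s = (b \<otimes> s) \<otimes> u" using *(3) cl by algebra
    also have "\<dots> = (a \<otimes> t) \<otimes> u" by (simp only: *(5))
    also have "\<dots> = (a \<otimes> u) \<otimes> t" using *(1) cl by algebra
    also have "\<dots> = (c \<otimes> t) \<otimes> s" unfolding c(3) using c(1) cl by algebra
    finally have e: "(b \<otimes> u) \<otimes> s = (c \<otimes> t) \<otimes> s" .
    have "b \<otimes> u = c \<otimes> t" using nzd_cancel[OF *(2) _ _ e] *(3) cl c(1) by simp
    then show "(c, u) \<in> fraction R b t" using c by (simp add: fraction_def)
  qed
  assume eq: "a \<otimes> t = b \<otimes> s"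
  show "fraction R a s = fraction R b t"
    by (rule subset_antisym[OF *[OF assms eq] *[OF assms(3,4,1,2) eq[symmetric]]])
qed

lemma fraction_memD:
  assumes "(b, t) \<in> fraction R a s" "a \<in> carrier R" "s \<in> nonzerodivisors R"
  shows "b \<in> carrier R" "t \<in> nonzerodivisors R" "a \<otimes> t = b \<otimes> s"
  using assms by (auto simp: fraction_def)

lemma total_fractions_mult:
  assumes "a \<in> carrier R" "s \<in> nonzerodivisors R" "b \<in> carrier R" "t \<in> nonzerodivisors R"
  shows "fraction R a s \<otimes>\<^bsub>total_fractions R\<^esub> fraction R b t = fraction R (a \<otimes> b) (s \<otimes> t)"
proof -
  have "fraction R (a' \<otimes> b') (s' \<otimes> t') = fraction R (a \<otimes> b) (s \<otimes> t)"
    if "(a', s') \<in> fraction R a s" "(b', t') \<in> fraction R b t" for a' b' s' t'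
  proof -
    note 1 = fraction_memD[OF that(1) assms(1,2)] and 2 = fraction_memD[OF that(2) assms(3,4)]
    have cl: "s \<in> carrier R" "t \<in> carrier R" "s' \<in> carrier R" "t' \<in> carrier R"
      using assms(2,4) 1(2) 2(2) nzd_carrier by auto
    have "(a' \<otimes> b') \<otimes> (s \<otimes> t) = (a' \<otimes> s) \<otimes> (b' \<otimes> t)" using cl 1(1) 2(1) by (simp add: l_distr m_ac)
    also have "\<dots> = (a \<otimes> s') \<otimes> (b \<otimes> t')" by (simp only: 1(3) 2(3))
    also have "\<dots> = (a \<otimes> b) \<otimes> (s' \<otimes> t')" using cl assms(1,3) by (simp add: l_distr m_ac)
    finally show ?thesis using 1(1,2) 2(1,2) assms by (simp add: fraction_eq_iff nzd_mult)
  qed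
  then have "{fraction R (a' \<otimes> b') (s' \<otimes> t') | a' s' b' t'.
      (a', s') \<in> fraction R a s \<and> (b', t') \<in> fraction R b t}
    = {fraction R (a \<otimes> b) (s \<otimes> t)}"
    using mem_fraction_self[OF assms(1,2)] mem_fraction_self[OF assms(3,4)] by blast
  then show ?thesis by (simp add: total_fractions_def)
qed

lemma total_fractions_add:
  assumes "a \<in> carrier R" "s \<in> nonzerodivisors R" "b \<in> carrier R" "t \<in> nonzerodivisors R"
  shows "fraction R a s \<oplus>\<^bsub>total_fractions R\<^esub> fraction R b t = fraction R (a \<otimes> t \<oplus> b \<otimes> s) (s \<otimes> t)"
proof -
  have "fraction R (a' \<otimes> t' \<oplus> b' \<otimes> s') (s' \<otimes> t') = fraction R (a \<otimes> t \<oplus> b \<otimes> s) (s \<otimes> t)"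
    if "(a', s') \<in> fraction R a s" "(b', t') \<in> fraction R b t" for a' b' s' t'
  proof -
    note 1 = fraction_memD[OF that(1) assms(1,2)] and 2 = fraction_memD[OF that(2) assms(3,4)]
    have cl: "s \<in> carrier R" "t \<in> carrier R" "s' \<in> carrier R" "t' \<in> carrier R"
      using assms(2,4) 1(2) 2(2) nzd_carrier by auto
    have "(a' \<otimes> t' \<oplus> b' \<otimes> s') \<otimes> (s \<otimes> t)
        = (a' \<otimes> s) \<otimes> (t \<otimes> t') \<oplus> (b' \<otimes> t) \<otimes> (s \<otimes> s')" using cl 1(1) 2(1) by algebra
    also have "\<dots> = (a \<otimes> s') \<otimes> (t \<otimes> t') \<oplus> (b \<otimes> t') \<otimes> (s \<otimes> s')"
      by (simp only: 1(3) 2(3))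
    also have "\<dots> = (a \<otimes> t \<oplus> b \<otimes> s) \<otimes> (s' \<otimes> t')" using cl assms(1,3) by algebra
    finally show ?thesis using 1(1,2) 2(1,2) assms cl by (simp add: fraction_eq_iff nzd_mult)
  qed
  then have "{fraction R (a' \<otimes> t' \<oplus> b' \<otimes> s') (s' \<otimes> t') | a' s' b' t'.
      (a', s') \<in> fraction R a s \<and> (b', t') \<in> fraction R b t}
    = {fraction R (a \<otimes> t \<oplus> b \<otimes> s) (s \<otimes> t)}"
    using mem_fraction_self[OF assms(1,2)] mem_fraction_self[OF assms(3,4)] by blast
  then show ?thesis by (simp add: total_fractions_def)
qed

lemma total_fractions_carrier:
  "carrier (total_fractions R) = {fraction R a s | a s. a \<in> carrier R \<and> s \<in> nonzerodivisors R}"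
  "\<one>\<^bsub>total_fractions R\<^esub> = fraction R \<one> \<one>" "\<zero>\<^bsub>total_fractions R\<^esub> = fraction R \<zero> \<one>"
  by (simp_all add: total_fractions_def)

lemma fraction_in_carrier:
  "\<lbrakk>a \<in> carrier R; s \<in> nonzerodivisors R\<rbrakk> \<Longrightarrow> fraction R a s \<in> carrier (total_fractions R)"
  by (auto simp: total_fractions_carrier)

lemma total_fractions_cring: "cring (total_fractions R)"
proof (rule cringI)
  show "abelian_group (total_fractions R)"
  proof (rule abelian_groupI)
    fix x assume "x \<in> carrier (total_fractions R)"
    then obtain a s where x: "x = fraction R a s" "a \<in> carrier R" "s \<in> nonzerodivisors R"
      by (auto simp: total_fractions_carrier)
    have s: "s \<in> carrier R" using x nzd_carrier by simp
    have "fraction R (\<ominus> a) s \<oplus>\<^bsub>total_fractions R\<^esub> x = fraction R ((\<ominus> a) \<otimes> s \<oplus> a \<otimes> s) (s \<otimes> s)"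
      using x by (simp add: total_fractions_add)
    also have "(\<ominus> a) \<otimes> s \<oplus> a \<otimes> s = \<zero>" using x s by algebra
    also have "fraction R \<zero> (s \<otimes> s) = \<zero>\<^bsub>total_fractions R\<^esub>"
      using x s by (simp add: total_fractions_carrier fraction_eq_iff nzd_mult)
    finally show "\<exists>y \<in> carrier (total_fractions R).
        y \<oplus>\<^bsub>total_fractions R\<^esub> x = \<zero>\<^bsub>total_fractions R\<^esub>"
      using x by (intro bexI[of _ "fraction R (\<ominus> a) s"]) (auto simp: total_fractions_carrier)
  next
    fix x y z
    assume "x \<in> carrier (total_fractions R)" "y \<in> carrier (total_fractions R)"
      "z \<in> carrier (total_fractions R)"
    then obtain a s b t c u where *: "x = fraction R a s" "a \<in> carrier R" "s \<in> nonzerodivisors R"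
      "y = fraction R b t" "b \<in> carrier R" "t \<in> nonzerodivisors R"
      "z = fraction R c u" "c \<in> carrier R" "u \<in> nonzerodivisors R"
      by (auto simp: total_fractions_carrier)
    have cl: "s \<in> carrier R" "t \<in> carrier R" "u \<in> carrier R" using * nzd_carrier by auto
    have "(a \<otimes> t \<oplus> b \<otimes> s) \<otimes> u \<oplus> c \<otimes> (s \<otimes> t)
        = a \<otimes> (t \<otimes> u) \<oplus> (b \<otimes> u \<oplus> c \<otimes> t) \<otimes> s"
      using * cl by algebra
    then show "x \<oplus>\<^bsub>total_fractions R\<^esub> y \<oplus>\<^bsub>total_fractions R\<^esub> z
        = x \<oplus>\<^bsub>total_fractions R\<^esub> (y \<oplus>\<^bsub>total_fractions R\<^esub> z)"
      using * cl by (simp add: total_fractions_add nzd_mult m_assoc)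
  next
    fix x y
    assume "x \<in> carrier (total_fractions R)" "y \<in> carrier (total_fractions R)"
    then obtain a s b t where *: "x = fraction R a s" "a \<in> carrier R" "s \<in> nonzerodivisors R"
      "y = fraction R b t" "b \<in> carrier R" "t \<in> nonzerodivisors R"
      by (auto simp: total_fractions_carrier)
    have cl: "s \<in> carrier R" "t \<in> carrier R" using * nzd_carrier by auto
    show "x \<oplus>\<^bsub>total_fractions R\<^esub> y = y \<oplus>\<^bsub>total_fractions R\<^esub> x"
      using * cl by (simp add: total_fractions_add a_comm m_comm)
    show "x \<oplus>\<^bsub>total_fractions R\<^esub> y \<in> carrier (total_fractions R)"
      using * cl by (simp add: total_fractions_add fraction_in_carrier nzd_mult)
  next
    show "\<zero>\<^bsub>total_fractions R\<^esub> \<in> carrier (total_fractions R)"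
      using fraction_in_carrier[OF zero_closed nzd_one] by (simp add: total_fractions_carrier)
  next
    fix x assume "x \<in> carrier (total_fractions R)"
    then obtain a s where x: "x = fraction R a s" "a \<in> carrier R" "s \<in> nonzerodivisors R"
      by (auto simp: total_fractions_carrier)
    then show "\<zero>\<^bsub>total_fractions R\<^esub> \<oplus>\<^bsub>total_fractions R\<^esub> x = x"
      using nzd_carrier by (simp add: total_fractions_add total_fractions_carrier)
  qed
  show "comm_monoid (total_fractions R)"
  proof (rule comm_monoidI)
    fix x y z
    assume "x \<in> carrier (total_fractions R)" "y \<in> carrier (total_fractions R)"
      "z \<in> carrier (total_fractions R)"
    then obtain a s b t c u where *: "x = fraction R a s" "a \<in> carrier R" "s \<in> nonzerodivisors R"
      "y = fraction R b t" "b \<in> carrier R" "t \<in> nonzerodivisors R"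
      "z = fraction R c u" "c \<in> carrier R" "u \<in> nonzerodivisors R"
      by (auto simp: total_fractions_carrier)
    then show "x \<otimes>\<^bsub>total_fractions R\<^esub> y \<otimes>\<^bsub>total_fractions R\<^esub> z
        = x \<otimes>\<^bsub>total_fractions R\<^esub> (y \<otimes>\<^bsub>total_fractions R\<^esub> z)"
      using nzd_carrier by (simp add: total_fractions_mult nzd_mult m_assoc)
  next
    fix x y
    assume "x \<in> carrier (total_fractions R)" "y \<in> carrier (total_fractions R)"
    then obtain a s b t where *: "x = fraction R a s" "a \<in> carrier R" "s \<in> nonzerodivisors R"
      "y = fraction R b t" "b \<in> carrier R" "t \<in> nonzerodivisors R"
      by (auto simp: total_fractions_carrier)
    show "x \<otimes>\<^bsub>total_fractions R\<^esub> y = y \<otimes>\<^bsub>total_fractions R\<^esub> x"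
      using * nzd_carrier by (simp add: total_fractions_mult m_comm)
    show "x \<otimes>\<^bsub>total_fractions R\<^esub> y \<in> carrier (total_fractions R)"
      using * by (simp add: total_fractions_mult fraction_in_carrier nzd_mult)
  next
    show "\<one>\<^bsub>total_fractions R\<^esub> \<in> carrier (total_fractions R)"
      using fraction_in_carrier[OF one_closed nzd_one] by (simp add: total_fractions_carrier)
  next
    fix x assume "x \<in> carrier (total_fractions R)"
    then obtain a s where x: "x = fraction R a s" "a \<in> carrier R" "s \<in> nonzerodivisors R"
      by (auto simp: total_fractions_carrier)
    then show "\<one>\<^bsub>total_fractions R\<^esub> \<otimes>\<^bsub>total_fractions R\<^esub> x = x"
      using nzd_carrier by (simp add: total_fractions_mult total_fractions_carrier)
  qed
next
  fix x y z
  assume "x \<in> carrier (total_fractions R)" "y \<in> carrier (total_fractions R)"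
    "z \<in> carrier (total_fractions R)"
  then obtain a s b t c u where *: "x = fraction R a s" "a \<in> carrier R" "s \<in> nonzerodivisors R"
    "y = fraction R b t" "b \<in> carrier R" "t \<in> nonzerodivisors R"
    "z = fraction R c u" "c \<in> carrier R" "u \<in> nonzerodivisors R"
    by (auto simp: total_fractions_carrier)
  have cl: "s \<in> carrier R" "t \<in> carrier R" "u \<in> carrier R" using * nzd_carrier by auto
  have "((a \<otimes> t \<oplus> b \<otimes> s) \<otimes> c) \<otimes> ((s \<otimes> u) \<otimes> (t \<otimes> u))
      = ((a \<otimes> c) \<otimes> (t \<otimes> u) \<oplus> (b \<otimes> c) \<otimes> (s \<otimes> u)) \<otimes> ((s \<otimes> t) \<otimes> u)"
    using * cl by algebra
  then show "(x \<oplus>\<^bsub>total_fractions R\<^esub> y) \<otimes>\<^bsub>total_fractions R\<^esub> z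
      = x \<otimes>\<^bsub>total_fractions R\<^esub> z \<oplus>\<^bsub>total_fractions R\<^esub> y \<otimes>\<^bsub>total_fractions R\<^esub> z"
    using * cl by (simp add: total_fractions_add total_fractions_mult nzd_mult fraction_eq_iff)
qed

lemma to_fractions_hom: "to_fractions R \<in> ring_hom R (total_fractions R)"
  by (rule ring_hom_memI)
     (simp_all add: to_fractions_def fraction_in_carrier total_fractions_carrier(2)
        total_fractions_mult total_fractions_add)

end


section \<open>Extension of scalars\<close>

text \<open>For an \<open>R\<close>-module \<open>M\<close> and a ring homomorphism \<open>\<phi> : R \<rightarrow> Q\<close>, the tensor product
  \<open>M \<otimes>\<^sub>R Q\<close> is the free abelian group on \<open>M \<times> Q\<close> modulo the subgroup generated by the
  bilinearity relations; \<open>Q\<close> acts through the second factor. In HOL-Algebra's free abelian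
  group, \<open>frag_of\<close> embeds the generators and \<open>frag_extend\<close> extends a map on generators
  additively.\<close>

definition tensor_free ::
    "('a, 'm, 'c) module_scheme \<Rightarrow> ('q, 'd) ring_scheme \<Rightarrow> ('m \<times> 'q \<Rightarrow>\<^sub>0 int) monoid"
  where "tensor_free M Q = free_Abelian_group (carrier M \<times> carrier Q)"

definition tensor_relations ::
    "('a, 'b) ring_scheme \<Rightarrow> ('a, 'm, 'c) module_scheme \<Rightarrow> ('q, 'd) ring_scheme \<Rightarrow>
     ('a \<Rightarrow> 'q) \<Rightarrow> ('m \<times> 'q \<Rightarrow>\<^sub>0 int) set"
  where "tensor_relations R M Q \<phi> =
      {frag_of (x \<oplus>\<^bsub>M\<^esub> y, q) - (frag_of (x, q) + frag_of (y, q)) | x y q.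
         x \<in> carrier M \<and> y \<in> carrier M \<and> q \<in> carrier Q}
    \<union> {frag_of (x, p \<oplus>\<^bsub>Q\<^esub> q) - (frag_of (x, p) + frag_of (x, q)) | x p q.
         x \<in> carrier M \<and> p \<in> carrier Q \<and> q \<in> carrier Q}
    \<union> {frag_of (a \<odot>\<^bsub>M\<^esub> x, q) - frag_of (x, \<phi> a \<otimes>\<^bsub>Q\<^esub> q) | a x q.
         a \<in> carrier R \<and> x \<in> carrier M \<and> q \<in> carrier Q}"

definition tensor_kernel ::
    "('a, 'b) ring_scheme \<Rightarrow> ('a, 'm, 'c) module_scheme \<Rightarrow> ('q, 'd) ring_scheme \<Rightarrow>
     ('a \<Rightarrow> 'q) \<Rightarrow> ('m \<times> 'q \<Rightarrow>\<^sub>0 int) set"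
  where "tensor_kernel R M Q \<phi> = generate (tensor_free M Q) (tensor_relations R M Q \<phi>)"

definition tensor_scale ::
    "('q, 'd) ring_scheme \<Rightarrow> 'q \<Rightarrow> ('m \<times> 'q \<Rightarrow>\<^sub>0 int) \<Rightarrow> ('m \<times> 'q \<Rightarrow>\<^sub>0 int)"
  where "tensor_scale Q q = frag_extend (\<lambda>(x, p). frag_of (x, q \<otimes>\<^bsub>Q\<^esub> p))"

text \<open>The fields \<open>mult\<close> and \<open>one\<close> of a module record play no role in the locale \<open>module\<close>.\<close>

definition extend_scalars ::
    "('a, 'b) ring_scheme \<Rightarrow> ('a, 'm, 'c) module_scheme \<Rightarrow> ('q, 'd) ring_scheme \<Rightarrow>
     ('a \<Rightarrow> 'q) \<Rightarrow> ('q, ('m \<times> 'q \<Rightarrow>\<^sub>0 int) set) module"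
  where "extend_scalars R M Q \<phi> =
    (let F = tensor_free M Q; K = tensor_kernel R M Q \<phi> in
     \<lparr>carrier = carrier (F Mod K), monoid.mult = undefined, one = undefined,
      ring.zero = \<one>\<^bsub>F Mod K\<^esub>, ring.add = monoid.mult (F Mod K),
      smult = (\<lambda>q C. \<Union>c \<in> C. K #>\<^bsub>F\<^esub> tensor_scale Q q c)\<rparr>)"


locale scalar_extension = module R M + Q?: cring Q
  for R (structure) and M (structure) and Q (structure) +
  fixes \<phi>
  assumes hom: "\<phi> \<in> ring_hom R Q"
begin

abbreviation "F \<equiv> tensor_free M Q"
abbreviation "K \<equiv> tensor_kernel R M Q \<phi>"
abbreviation "E \<equiv> extend_scalars R M Q \<phi>"

lemma F_comm_group: "comm_group F"
  by (simp add: tensor_free_def abelian_free_Abelian_group)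

lemma F_group: "group F"
  by (simp add: tensor_free_def)

lemma F_simps [simp]:
  "c \<otimes>\<^bsub>F\<^esub> d = c + d" "\<one>\<^bsub>F\<^esub> = 0" "c \<in> carrier F \<Longrightarrow> inv\<^bsub>F\<^esub> c = - c"
  by (simp_all add: tensor_free_def)

lemma F_frag_of: "\<lbrakk>x \<in> carrier M; q \<in> carrier Q\<rbrakk> \<Longrightarrow> frag_of (x, q) \<in> carrier F"
  by (simp add: tensor_free_def)

lemma F_zero: "0 \<in> carrier F"
  by (simp add: tensor_free_def)

lemma F_add: "\<lbrakk>c \<in> carrier F; d \<in> carrier F\<rbrakk> \<Longrightarrow> c + d \<in> carrier F"
  using keys_add[of c d] by (auto simp: tensor_free_def)

lemma F_diff: "\<lbrakk>c \<in> carrier F; d \<in> carrier F\<rbrakk> \<Longrightarrow> c - d \<in> carrier F"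
  using keys_diff[of c d] by (auto simp: tensor_free_def)

lemma F_induct [consumes 1, case_names zero diff gen]:
  assumes "c \<in> carrier F" "P 0"
    "\<And>c d. \<lbrakk>c \<in> carrier F; d \<in> carrier F; P c; P d\<rbrakk> \<Longrightarrow> P (c - d)"
    "\<And>x q. \<lbrakk>x \<in> carrier M; q \<in> carrier Q\<rbrakk> \<Longrightarrow> P (frag_of (x, q))"
  shows "P c"
  using assms unfolding tensor_free_def
  by (intro free_Abelian_group_induct[of c "carrier M \<times> carrier Q" P]) auto

lemma hom_closed: "a \<in> carrier R \<Longrightarrow> \<phi> a \<in> carrier Q"
  using hom by (rule ring_hom_closed)

lemma relation_add_left:
  "\<lbrakk>x \<in> carrier M; y \<in> carrier M; q \<in> carrier Q\<rbrakk> \<Longrightarrow>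
    frag_of (x \<oplus>\<^bsub>M\<^esub> y, q) - (frag_of (x, q) + frag_of (y, q)) \<in> tensor_relations R M Q \<phi>"
  unfolding tensor_relations_def by (rule UnI1, rule UnI1, intro CollectI exI conjI, rule refl)

lemma relation_add_right:
  "\<lbrakk>x \<in> carrier M; p \<in> carrier Q; q \<in> carrier Q\<rbrakk> \<Longrightarrow>
    frag_of (x, p \<oplus>\<^bsub>Q\<^esub> q) - (frag_of (x, p) + frag_of (x, q)) \<in> tensor_relations R M Q \<phi>"
  unfolding tensor_relations_def by (rule UnI1, rule UnI2, intro CollectI exI conjI, rule refl)

lemma relation_smult:
  "\<lbrakk>a \<in> carrier R; x \<in> carrier M; q \<in> carrier Q\<rbrakk> \<Longrightarrow>
    frag_of (a \<odot>\<^bsub>M\<^esub> x, q) - frag_of (x, \<phi> a \<otimes>\<^bsub>Q\<^esub> q) \<in> tensor_relations R M Q \<phi>"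
  unfolding tensor_relations_def by (rule UnI2, intro CollectI exI conjI, rule refl)

lemma relations_F: "tensor_relations R M Q \<phi> \<subseteq> carrier F"
  unfolding tensor_relations_def by (auto intro!: F_diff F_add F_frag_of hom_closed)

lemma K_subgroup: "subgroup K F"
  unfolding tensor_kernel_def by (rule group.generate_is_subgroup[OF F_group relations_F])

lemma K_normal: "K \<lhd> F"
  by (rule comm_group.subgroup_imp_normal[OF F_comm_group K_subgroup])

lemma relation_K: "c \<in> tensor_relations R M Q \<phi> \<Longrightarrow> c \<in> K"
  unfolding tensor_kernel_def by (rule generate.incl)

lemma K_F: "c \<in> K \<Longrightarrow> c \<in> carrier F"
  using subgroup.subset[OF K_subgroup] by auto

lemma K_zero: "0 \<in> K"
  using subgroup.one_closed[OF K_subgroup] by simp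

lemma K_add: "\<lbrakk>c \<in> K; d \<in> K\<rbrakk> \<Longrightarrow> c + d \<in> K"
  using subgroup.m_closed[OF K_subgroup, of c d] by simp

lemma K_minus: "c \<in> K \<Longrightarrow> - c \<in> K"
  using subgroup.m_inv_closed[OF K_subgroup, of c] K_F by simp

lemma K_diff: "\<lbrakk>c \<in> K; d \<in> K\<rbrakk> \<Longrightarrow> c - d \<in> K"
  using K_add[OF _ K_minus, of c d] by simp

lemma coset_eq:
  assumes "c \<in> carrier F" "d \<in> carrier F" "c - d \<in> K"
  shows "K #>\<^bsub>F\<^esub> c = K #>\<^bsub>F\<^esub> d"
proof -
  have "c \<in> K #>\<^bsub>F\<^esub> d" using assms(3) by (auto simp: r_coset_def intro!: bexI[of _ "c - d"])
  then show ?thesis using group.repr_independence[OF F_group _ assms(2) K_subgroup] by simp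
qed

lemma scale_frag_of [simp]: "tensor_scale Q q (frag_of (x, p)) = frag_of (x, q \<otimes>\<^bsub>Q\<^esub> p)"
  by (simp add: tensor_scale_def)

lemma scale_linear [simp]:
  "tensor_scale Q q 0 = 0" "tensor_scale Q q (c + d) = tensor_scale Q q c + tensor_scale Q q d"
  "tensor_scale Q q (c - d) = tensor_scale Q q c - tensor_scale Q q d"
  "tensor_scale Q q (- c) = - tensor_scale Q q c"
  by (simp_all add: tensor_scale_def frag_extend_add frag_extend_diff frag_extend_minus)

lemma scale_F: "\<lbrakk>q \<in> carrier Q; c \<in> carrier F\<rbrakk> \<Longrightarrow> tensor_scale Q q c \<in> carrier F"
  by (rotate_tac 1, induction c rule: F_induct) (auto intro: F_zero F_diff F_frag_of)

lemma scale_relation: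
  assumes q: "q \<in> carrier Q" and c: "c \<in> tensor_relations R M Q \<phi>"
  shows "tensor_scale Q q c \<in> K"
proof -
  consider x y p where "x \<in> carrier M" "y \<in> carrier M" "p \<in> carrier Q"
      "c = frag_of (x \<oplus>\<^bsub>M\<^esub> y, p) - (frag_of (x, p) + frag_of (y, p))"
    | x p p' where "x \<in> carrier M" "p \<in> carrier Q" "p' \<in> carrier Q"
      "c = frag_of (x, p \<oplus>\<^bsub>Q\<^esub> p') - (frag_of (x, p) + frag_of (x, p'))"
    | a x p where "a \<in> carrier R" "x \<in> carrier M" "p \<in> carrier Q"
      "c = frag_of (a \<odot>\<^bsub>M\<^esub> x, p) - frag_of (x, \<phi> a \<otimes>\<^bsub>Q\<^esub> p)"
    using c unfolding tensor_relations_def by (elim UnE CollectE exE conjE) (erule (3) that)+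
  then show ?thesis
  proof cases
    case 1
    then have "tensor_scale Q q c = frag_of (x \<oplus>\<^bsub>M\<^esub> y, q \<otimes>\<^bsub>Q\<^esub> p)
        - (frag_of (x, q \<otimes>\<^bsub>Q\<^esub> p) + frag_of (y, q \<otimes>\<^bsub>Q\<^esub> p))"
      by simp
    moreover have "q \<otimes>\<^bsub>Q\<^esub> p \<in> carrier Q" using 1(3) q by simp
    ultimately show ?thesis using 1(1,2) by (simp only: relation_K relation_add_left)
  next
    case 2
    then have "tensor_scale Q q c = frag_of (x, q \<otimes>\<^bsub>Q\<^esub> p \<oplus>\<^bsub>Q\<^esub> q \<otimes>\<^bsub>Q\<^esub> p')
        - (frag_of (x, q \<otimes>\<^bsub>Q\<^esub> p) + frag_of (x, q \<otimes>\<^bsub>Q\<^esub> p'))"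
      using q by (simp add: Q.r_distr)
    moreover have "q \<otimes>\<^bsub>Q\<^esub> p \<in> carrier Q" "q \<otimes>\<^bsub>Q\<^esub> p' \<in> carrier Q" using 2 q by simp_all
    ultimately show ?thesis using 2(1) by (simp only: relation_K relation_add_right)
  next
    case 3
    then have "tensor_scale Q q c
        = frag_of (a \<odot>\<^bsub>M\<^esub> x, q \<otimes>\<^bsub>Q\<^esub> p) - frag_of (x, \<phi> a \<otimes>\<^bsub>Q\<^esub> (q \<otimes>\<^bsub>Q\<^esub> p))"
      using q hom_closed[of a] by (simp add: Q.m_lcomm)
    moreover have "q \<otimes>\<^bsub>Q\<^esub> p \<in> carrier Q" using 3 q by simp
    ultimately show ?thesis using 3(1,2) by (simp only: relation_K relation_smult)
  qed
qed

lemma scale_K: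
  assumes "q \<in> carrier Q" "c \<in> K"
  shows "tensor_scale Q q c \<in> K"
  using assms(2) unfolding tensor_kernel_def
proof (induction rule: generate.induct)
  case one
  then show ?case using K_zero by (simp add: tensor_kernel_def)
next
  case (incl h)
  then show ?case using scale_relation[OF assms(1)] by (simp add: tensor_kernel_def)
next
  case (inv h)
  moreover have "h \<in> carrier F" using inv relations_F by auto
  ultimately show ?case
    using K_minus[OF scale_relation[OF assms(1), of h]] by (simp add: tensor_kernel_def)
next
  case (eng h1 h2)
  then show ?case using K_add unfolding tensor_kernel_def by simp
qed

lemma E_simps:
  "carrier E = (\<lambda>c. K #>\<^bsub>F\<^esub> c) ` carrier F" "\<zero>\<^bsub>E\<^esub> = K"
  "C \<oplus>\<^bsub>E\<^esub> D = C <#>\<^bsub>F\<^esub> D"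
  "q \<odot>\<^bsub>E\<^esub> C = (\<Union>c \<in> C. K #>\<^bsub>F\<^esub> tensor_scale Q q c)"
  by (simp_all add: extend_scalars_def Let_def carrier_FactGroup)

lemma E_add:
  "\<lbrakk>c \<in> carrier F; d \<in> carrier F\<rbrakk> \<Longrightarrow> (K #>\<^bsub>F\<^esub> c) \<oplus>\<^bsub>E\<^esub> (K #>\<^bsub>F\<^esub> d) = K #>\<^bsub>F\<^esub> (c + d)"
  using normal.rcos_sum[OF K_normal] by (simp add: E_simps)

lemma E_smult:
  assumes "q \<in> carrier Q" "c \<in> carrier F"
  shows "q \<odot>\<^bsub>E\<^esub> (K #>\<^bsub>F\<^esub> c) = K #>\<^bsub>F\<^esub> tensor_scale Q q c"
proof -
  have "K #>\<^bsub>F\<^esub> tensor_scale Q q d = K #>\<^bsub>F\<^esub> tensor_scale Q q c" if d: "d \<in> K #>\<^bsub>F\<^esub> c" for d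
  proof -
    obtain k where k: "k \<in> K" "d = k + c" using d by (auto simp: r_coset_def)
    have "d \<in> carrier F" using k assms K_F F_add by auto
    then show ?thesis using k assms scale_K by (intro coset_eq scale_F) simp_all
  qed
  moreover have "c \<in> K #>\<^bsub>F\<^esub> c" by (rule group.rcos_self[OF F_group assms(2) K_subgroup])
  ultimately show ?thesis unfolding E_simps by blast
qed

lemma E_zero: "\<zero>\<^bsub>E\<^esub> = K #>\<^bsub>F\<^esub> 0"
  by (simp add: E_simps r_coset_def)

lemma E_abelian_group: "abelian_group E"
proof (rule abelian_groupI)
  fix C D G assume "C \<in> carrier E" "D \<in> carrier E" "G \<in> carrier E"
  then obtain c d g where "c \<in> carrier F" "C = K #>\<^bsub>F\<^esub> c" "d \<in> carrier F" "D = K #>\<^bsub>F\<^esub> d"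
    "g \<in> carrier F" "G = K #>\<^bsub>F\<^esub> g"
    by (auto simp: E_simps)
  then show "C \<oplus>\<^bsub>E\<^esub> D \<oplus>\<^bsub>E\<^esub> G = C \<oplus>\<^bsub>E\<^esub> (D \<oplus>\<^bsub>E\<^esub> G)"
    by (simp add: E_add F_add add.assoc)
next
  fix C D assume "C \<in> carrier E" "D \<in> carrier E"
  then obtain c d where *: "c \<in> carrier F" "C = K #>\<^bsub>F\<^esub> c" "d \<in> carrier F" "D = K #>\<^bsub>F\<^esub> d"
    by (auto simp: E_simps)
  then show "C \<oplus>\<^bsub>E\<^esub> D = D \<oplus>\<^bsub>E\<^esub> C" by (simp add: E_add add.commute)
  show "C \<oplus>\<^bsub>E\<^esub> D \<in> carrier E" using * by (simp add: E_add) (simp add: E_simps F_add)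
next
  show "\<zero>\<^bsub>E\<^esub> \<in> carrier E" unfolding E_zero by (simp add: E_simps F_zero)
next
  fix C assume "C \<in> carrier E"
  then obtain c where c: "c \<in> carrier F" "C = K #>\<^bsub>F\<^esub> c"
    by (auto simp: E_simps)
  then show "\<zero>\<^bsub>E\<^esub> \<oplus>\<^bsub>E\<^esub> C = C" by (simp add: E_zero E_add F_zero)
  have m: "- c \<in> carrier F" using F_diff[OF F_zero c(1)] by simp
  show "\<exists>D \<in> carrier E. D \<oplus>\<^bsub>E\<^esub> C = \<zero>\<^bsub>E\<^esub>"
  proof
    show "K #>\<^bsub>F\<^esub> (- c) \<in> carrier E" using m by (simp add: E_simps)
    show "(K #>\<^bsub>F\<^esub> (- c)) \<oplus>\<^bsub>E\<^esub> C = \<zero>\<^bsub>E\<^esub>" using c m by (simp add: E_zero E_add)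
  qed
qed

lemma scale_add_left:
  assumes "c \<in> carrier F" "p \<in> carrier Q" "q \<in> carrier Q"
  shows "tensor_scale Q (p \<oplus>\<^bsub>Q\<^esub> q) c - (tensor_scale Q p c + tensor_scale Q q c) \<in> K"
  using assms(1)
proof (induction c rule: F_induct)
  case zero
  then show ?case by (simp add: K_zero)
next
  case (diff c d)
  have "tensor_scale Q (p \<oplus>\<^bsub>Q\<^esub> q) (c - d) - (tensor_scale Q p (c - d) + tensor_scale Q q (c - d))
    = (tensor_scale Q (p \<oplus>\<^bsub>Q\<^esub> q) c - (tensor_scale Q p c + tensor_scale Q q c))
      - (tensor_scale Q (p \<oplus>\<^bsub>Q\<^esub> q) d - (tensor_scale Q p d + tensor_scale Q q d))"
    by simp
  then show ?case using K_diff[OF diff(3,4)] by (simp only:)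
next
  case (gen x r)
  have "p \<otimes>\<^bsub>Q\<^esub> r \<in> carrier Q" "q \<otimes>\<^bsub>Q\<^esub> r \<in> carrier Q" using gen assms by simp_all
  then have "frag_of (x, p \<otimes>\<^bsub>Q\<^esub> r \<oplus>\<^bsub>Q\<^esub> q \<otimes>\<^bsub>Q\<^esub> r)
      - (frag_of (x, p \<otimes>\<^bsub>Q\<^esub> r) + frag_of (x, q \<otimes>\<^bsub>Q\<^esub> r)) \<in> K"
    using gen(1) by (intro relation_K relation_add_right)
  then show ?case using gen assms by (simp add: Q.l_distr)
qed

lemma scale_assoc:
  assumes "c \<in> carrier F" "p \<in> carrier Q" "q \<in> carrier Q"
  shows "tensor_scale Q (p \<otimes>\<^bsub>Q\<^esub> q) c = tensor_scale Q p (tensor_scale Q q c)"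
  using assms(1) by (induction c rule: F_induct) (use assms in \<open>simp_all add: Q.m_assoc\<close>)

lemma scale_one: "c \<in> carrier F \<Longrightarrow> tensor_scale Q \<one>\<^bsub>Q\<^esub> c = c"
  by (induction c rule: F_induct) simp_all

lemma extend_scalars_module: "module Q E"
proof (rule moduleI[OF Q.is_cring E_abelian_group])
  fix p q C D
  assume "p \<in> carrier Q" "C \<in> carrier E"
  then obtain c where c: "c \<in> carrier F" "C = K #>\<^bsub>F\<^esub> c" and p: "p \<in> carrier Q"
    by (auto simp: E_simps)
  show "p \<odot>\<^bsub>E\<^esub> C \<in> carrier E" using c p by (simp add: E_smult) (simp add: E_simps scale_F)
  {
    assume "D \<in> carrier E"
    then obtain d where "d \<in> carrier F" "D = K #>\<^bsub>F\<^esub> d" by (auto simp: E_simps)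
    then show "p \<odot>\<^bsub>E\<^esub> (C \<oplus>\<^bsub>E\<^esub> D) = p \<odot>\<^bsub>E\<^esub> C \<oplus>\<^bsub>E\<^esub> p \<odot>\<^bsub>E\<^esub> D"
      using c p by (simp add: E_smult E_add F_add scale_F)
  }
  assume q: "q \<in> carrier Q"
  show "(p \<oplus>\<^bsub>Q\<^esub> q) \<odot>\<^bsub>E\<^esub> C = p \<odot>\<^bsub>E\<^esub> C \<oplus>\<^bsub>E\<^esub> q \<odot>\<^bsub>E\<^esub> C"
    using c p q coset_eq[OF _ _ scale_add_left[of c p q]] by (simp add: E_smult E_add scale_F F_add)
  show "(p \<otimes>\<^bsub>Q\<^esub> q) \<odot>\<^bsub>E\<^esub> C = p \<odot>\<^bsub>E\<^esub> (q \<odot>\<^bsub>E\<^esub> C)"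
    using c p q by (simp add: E_smult scale_assoc scale_F)
next
  fix C assume "C \<in> carrier E"
  then show "\<one>\<^bsub>Q\<^esub> \<odot>\<^bsub>E\<^esub> C = C" by (auto simp: E_simps(1) E_smult scale_one)
qed

end


lemma scalar_extension_total_fractions:
  "module R M \<Longrightarrow> scalar_extension R M (total_fractions R) (to_fractions R)"
  by (simp add: scalar_extension_def scalar_extension_axioms_def module.axioms(1)
      cring.total_fractions_cring cring.to_fractions_hom)


section \<open>Rank\<close>

text \<open>A basis is an indexed family, so that over the zero ring the zero module is free of
  every rank.\<close>

definition free_of_rank ::
    "('q, 'd) ring_scheme \<Rightarrow> ('q, 'n, 'e) module_scheme \<Rightarrow> nat \<Rightarrow> bool"
  where "free_of_rank Q N r \<longleftrightarrow> module Q N \<and>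
    (\<exists>b \<in> {..<r} \<rightarrow> carrier N. \<forall>x \<in> carrier N.
       \<exists>!c. c \<in> {..<r} \<rightarrow>\<^sub>E carrier Q \<and> x = (\<Oplus>\<^bsub>N\<^esub>i \<in> {..<r}. c i \<odot>\<^bsub>N\<^esub> b i))"

definition has_rank :: "('a, 'b) ring_scheme \<Rightarrow> ('a, 'm, 'c) module_scheme \<Rightarrow> nat \<Rightarrow> bool"
  where "has_rank R M r \<longleftrightarrow>
    free_of_rank (total_fractions R)
      (extend_scalars R M (total_fractions R) (to_fractions R)) r"

end

theory Submission
  imports Defs
begin

text \<open>An element \<open>x\<close> is integral over a regular ideal \<open>I\<close> exactly when \<open>x N \<subseteq> I N\<close> for some regular
  ideal \<open>N\<close>. For such an ideal \<open>N\<close>, which is finitely generated over a Noetherian ring, the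
  determinant trick gives a form in \<open>x\<close>, monic and with \<open>i\<close>-th coefficient in \<open>I\<^sup>i\<close>, that annihilates
  \<open>N\<close>; as \<open>N\<close> contains a nonzerodivisor, the form vanishes and is an equation of integral
  dependence (\<open>regular_multiplier_imp_integral\<close>). Conversely, an equation of degree \<open>d + 1\<close> says
  that \<open>I\<close> is a reduction of \<open>(I, x)\<close>, and \<open>N = (I, x)\<^sup>d\<close> serves
  (\<open>integral_imp_regular_multiplier\<close>).

  If \<open>x N \<subseteq> I N\<close> and \<open>y N' \<subseteq> I N'\<close>, then \<open>N N'\<close> serves for both \<open>x\<close> and \<open>y\<close>. The sets
  \<open>{x. x N \<subseteq> I N}\<close> are ideals, and so the integral closure, their directed union, is an ideal. It is
  finitely generated, hence a single regular ideal \<open>N\<close> works for all its elements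
  (\<open>integral_closure_common_multiplier\<close>).

  This \<open>N\<close>, regarded as a module, is the required \<open>M\<close>. It has rank \<open>1\<close> because it contains a
  nonzerodivisor. If \<open>x\<close> is integral, then \<open>x I N \<subseteq> I\<^sup>2 N\<close>, so \<open>x \<in> r(I, N)\<close> already at \<open>k = 1\<close>. If
  \<open>x \<in> r(I, N)\<close>, then \<open>x\<close> multiplies the regular ideal \<open>I\<^sup>k N\<close> into \<open>I (I\<^sup>k N)\<close> for some \<open>k\<close>, and so
  is integral. Thus \<open>r(I, N)\<close> equals the integral closure, and the same module serves for every \<open>J\<close>.\<close>


section \<open>Products and powers of ideals\<close>

context cring
begin

lemma ideal_subset_carrier: "ideal K R \<Longrightarrow> K \<subseteq> carrier R"
  by (auto intro: ideal.Icarr)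

lemma ideal_finsum_closed:
  assumes K: "ideal K R" and "\<And>i. i \<in> A \<Longrightarrow> f i \<in> K"
  shows "(\<Oplus>i \<in> A. f i) \<in> K"
  using assms(2)
proof (induction A rule: infinite_finite_induct)
  case (infinite A)
  then show ?case
    using K by (simp add: additive_subgroup.zero_closed ideal.axioms(1) add.finprod_infinite)
next
  case empty
  then show ?case using K by (simp add: additive_subgroup.zero_closed ideal.axioms(1))
next
  case (insert i A)
  then have "f \<in> A \<rightarrow> carrier R" "f i \<in> carrier R" using K by (auto intro: ideal.Icarr)
  then show ?case
    using insert K by (simp add: additive_subgroup.a_closed ideal.axioms(1))
qed

lemma ideal_sub_closed:
  assumes "ideal K R" "u \<in> K" "v \<in> K"
  shows "u \<ominus> v \<in> K"
  using assms unfolding a_minus_def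
  by (simp add: additive_subgroup.a_closed additive_subgroup.a_inv_closed ideal.axioms(1))

lemma ideal_prod_subsetI:
  assumes "ideal K R" "\<And>i j. \<lbrakk>i \<in> I; j \<in> J\<rbrakk> \<Longrightarrow> i \<otimes> j \<in> K"
  shows "I \<cdot> J \<subseteq> K"
proof
  fix y assume "y \<in> I \<cdot> J"
  then show "y \<in> K"
    by induction (use assms in \<open>auto intro: additive_subgroup.a_closed ideal.axioms(1)\<close>)
qed

lemma ideal_prod_mono: "\<lbrakk>I \<subseteq> I'; J \<subseteq> J'\<rbrakk> \<Longrightarrow> I \<cdot> J \<subseteq> I' \<cdot> J'"
proof
  fix y assume *: "I \<subseteq> I'" "J \<subseteq> J'" and "y \<in> I \<cdot> J"
  from this(3) show "y \<in> I' \<cdot> J'"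
    by induction (use * in \<open>auto intro: ideal_prod.intros\<close>)
qed

lemma ideal_multiplier:
  assumes J: "ideal J R" and K: "ideal K R"
  shows "ideal {x \<in> carrier R. \<forall>y \<in> J. x \<otimes> y \<in> K} R"
proof (rule idealI[OF ring_axioms])
  note [simp] = ideal.Icarr[OF J] ideal.Icarr[OF K]
  interpret K: ideal K R by (rule K)
  show "subgroup {x \<in> carrier R. \<forall>y \<in> J. x \<otimes> y \<in> K} (add_monoid R)"
    by (rule group.subgroupI[OF add.is_group])
       (auto simp: l_distr l_minus simp flip: a_inv_def intro!: exI[of _ \<zero>])
  fix a x assume a: "a \<in> {x \<in> carrier R. \<forall>y \<in> J. x \<otimes> y \<in> K}" and x: "x \<in> carrier R"
  have "x \<otimes> a \<otimes> y \<in> K" if "y \<in> J" for y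
    using a x that K.I_l_closed by (simp add: m_assoc)
  then show "x \<otimes> a \<in> {x \<in> carrier R. \<forall>y \<in> J. x \<otimes> y \<in> K}"
    using a x by simp
  then show "a \<otimes> x \<in> {x \<in> carrier R. \<forall>y \<in> J. x \<otimes> y \<in> K}"
    using a x by (simp add: m_comm)
qed

lemma ideal_prod_scaled_mem:
  assumes "ideal I R" "ideal J R" "ideal K R" "c \<in> carrier R"
    and "\<And>i j. \<lbrakk>i \<in> I; j \<in> J\<rbrakk> \<Longrightarrow> c \<otimes> (i \<otimes> j) \<in> K" and "y \<in> I \<cdot> J"
  shows "c \<otimes> y \<in> K"
  using assms(6)
proof induction
  case (prod i j)
  then show ?case by (rule assms(5))
next
  case (sum y z)
  then have "y \<in> carrier R" "z \<in> carrier R" using ideal_prod_in_carrier[OF assms(1,2)] by auto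
  then show ?case
    using sum assms(3,4) by (simp add: r_distr additive_subgroup.a_closed ideal.axioms(1))
qed

lemma principal_ideal_prod_cases:
  assumes "ideal K R" "n \<in> carrier R" "y \<in> K \<cdot> (PIdl n)"
  shows "\<exists>k \<in> K. y = k \<otimes> n"
  using assms(3)
proof induction
  case (prod i j)
  then obtain r where r: "r \<in> carrier R" "j = r \<otimes> n" by (auto simp: cgenideal_def)
  then have "i \<otimes> j = (i \<otimes> r) \<otimes> n" using prod assms ideal.Icarr[OF assms(1)] by (simp add: m_assoc)
  then show ?case using prod r ideal.I_r_closed[OF assms(1)] by blast
next
  case (sum y z)
  then obtain k l where "k \<in> K" "l \<in> K" "y = k \<otimes> n" "z = l \<otimes> n" by blast
  then show ?case
    using assms(1,2) ideal.Icarr[OF assms(1)] additive_subgroup.a_closed[OF ideal.axioms(1)]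
    by (metis l_distr)
qed

lemma genideal_insert:
  assumes "n \<in> carrier R" "S \<subseteq> carrier R"
  shows "Idl (insert n S) = set_add R (PIdl n) (Idl S)"
proof -
  have PI: "ideal (PIdl n) R" "ideal (Idl S) R" using assms by (auto intro: cgenideal_ideal genideal_ideal)
  have "Idl (insert n S) = Idl (PIdl n \<union> Idl S)"
  proof (rule subset_antisym)
    have "PIdl n \<union> Idl S \<subseteq> carrier R" using PI ideal_subset_carrier by blast
    then show "Idl (insert n S) \<subseteq> Idl (PIdl n \<union> Idl S)"
      using genideal_self[of "PIdl n \<union> Idl S"] genideal_self[OF assms(2)] cgenideal_self[OF assms(1)]
      by (intro genideal_minimal genideal_ideal) auto
    have "insert n S \<subseteq> Idl (insert n S)" using assms by (intro genideal_self) auto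
    then show "Idl (PIdl n \<union> Idl S) \<subseteq> Idl (insert n S)"
      using assms by (intro genideal_minimal genideal_ideal Un_least cgenideal_minimal) auto
  qed
  then show ?thesis using union_genideal[OF PI] by simp
qed

lemma ideal_pow_0: "ideal_pow R I 0 = carrier R"
  by (simp add: ideal_pow_def ideals_set_def nat_pow_def)

lemma ideal_pow_Suc: "ideal_pow R I (Suc k) = ideal_pow R I k \<cdot> I"
  by (simp add: ideal_pow_def ideals_set_def nat_pow_def)

lemma ideal_pow_ideal: "ideal I R \<Longrightarrow> ideal (ideal_pow R I k) R"
  by (induction k) (simp_all add: ideal_pow_0 ideal_pow_Suc oneideal ideal_prod_is_ideal)

lemma ideal_pow_1: "ideal I R \<Longrightarrow> ideal_pow R I (Suc 0) = I"
  by (simp add: ideal_pow_0 ideal_pow_Suc ideal_prod_commute[OF oneideal] ideal_prod_one)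

lemma ideal_pow_add:
  assumes "ideal I R"
  shows "ideal_pow R I k \<cdot> ideal_pow R I l = ideal_pow R I (k + l)"
proof (induction l)
  case 0
  then show ?case by (simp add: ideal_pow_0 ideal_prod_one ideal_pow_ideal assms)
next
  case (Suc l)
  then show ?case
    using ideal_prod_assoc[OF ideal_pow_ideal ideal_pow_ideal, OF assms assms assms, of k l]
    by (simp add: ideal_pow_Suc)
qed

lemma ideal_pow_mono: "I \<subseteq> J \<Longrightarrow> ideal_pow R I k \<subseteq> ideal_pow R J k"
  by (induction k) (simp_all add: ideal_pow_0 ideal_pow_Suc ideal_prod_mono)

lemma pow_mem_ideal_pow: "x \<in> I \<Longrightarrow> x [^] k \<in> ideal_pow R I k"
  by (induction k) (simp_all add: ideal_pow_0 ideal_pow_Suc ideal_prod.prod)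

lemma regular_ideal_prod:
  assumes "regular_ideal I R" "regular_ideal J R"
  shows "regular_ideal (I \<cdot> J) R"
  using assms ideal_prod_is_ideal nzd_mult ideal_prod.prod[of _ I _ J R]
  unfolding regular_ideal_def by blast

lemma regular_ideal_carrier: "regular_ideal (carrier R) R"
  using nzd_one one_closed oneideal unfolding regular_ideal_def by blast

lemma regular_ideal_pow: "regular_ideal I R \<Longrightarrow> regular_ideal (ideal_pow R I k) R"
  by (induction k) (simp_all add: ideal_pow_0 ideal_pow_Suc regular_ideal_carrier regular_ideal_prod)

lemma regular_ideal_superset: "\<lbrakk>regular_ideal I R; ideal J R; I \<subseteq> J\<rbrakk> \<Longrightarrow> regular_ideal J R"
  unfolding regular_ideal_def by blast


section \<open>Forms in an ideal and one further element\<close>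

text \<open>The ideal \<open>I (I, x)\<^sup>d\<close>: it consists of the values at \<open>x\<close> of the forms
  \<open>a\<^sub>1 X\<^sup>d + \<dots> + a\<^sub>d\<^sub>+\<^sub>1\<close> with \<open>a\<^sub>i \<in> I\<^sup>i\<close>.\<close>

definition lower_forms :: "'a set \<Rightarrow> 'a \<Rightarrow> nat \<Rightarrow> 'a set"
  where "lower_forms I x d = I \<cdot> ideal_pow R (set_add R I (PIdl x)) d"

text \<open>The values at \<open>x\<close> of the monic forms \<open>X\<^sup>d\<^sup>+\<^sup>1 + a\<^sub>1 X\<^sup>d + \<dots> + a\<^sub>d\<^sub>+\<^sub>1\<close> with \<open>a\<^sub>i \<in> I\<^sup>i\<close>. The index is
  one less than the degree, so that it agrees with that of \<open>lower_forms\<close> and degree \<open>0\<close>, in which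
  the only monic form is \<open>1\<close>, does not occur.\<close>

definition monic_forms :: "'a set \<Rightarrow> 'a \<Rightarrow> nat \<Rightarrow> 'a set"
  where "monic_forms I x d = {x [^] Suc d \<oplus> l | l. l \<in> lower_forms I x d}"

context
  fixes I x
  assumes I: "ideal I R" and x: "x \<in> carrier R"
begin

abbreviation "adjoined \<equiv> set_add R I (PIdl x)"
abbreviation "lforms \<equiv> lower_forms I x"

lemma adjoin_ideal: "ideal adjoined R"
  by (intro add_ideals I cgenideal_ideal x)

lemma adjoin_superset: "I \<subseteq> adjoined"
  unfolding set_add_def' using ideal.Icarr[OF I]
    additive_subgroup.zero_closed[OF ideal.axioms(1)[OF cgenideal_ideal[OF x]]] by force

lemma adjoin_self: "x \<in> adjoined"
proof -
  have "\<zero> \<oplus> x \<in> adjoined"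
    unfolding set_add_def' using cgenideal_self[OF x]
      additive_subgroup.zero_closed[OF ideal.axioms(1)[OF I]] by blast
  then show ?thesis using x by simp
qed

lemma adjoin_cases:
  assumes "y \<in> adjoined"
  obtains a r where "a \<in> I" "r \<in> carrier R" "y = a \<oplus> r \<otimes> x"
  using assms unfolding set_add_def' cgenideal_def by blast

lemmas adjoin_pow_ideal = ideal_pow_ideal[OF adjoin_ideal]

lemma lower_forms_ideal: "ideal (lforms d) R"
  unfolding lower_forms_def by (intro ideal_prod_is_ideal I adjoin_pow_ideal)

lemma lower_forms_0: "lforms 0 = I"
  by (simp add: lower_forms_def ideal_pow_0 ideal_prod_one I)

lemma lower_forms_subset: "lforms d \<subseteq> ideal_pow R adjoined (Suc d)"
proof -
  have "lforms d \<subseteq> adjoined \<cdot> ideal_pow R adjoined d"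
    unfolding lower_forms_def by (rule ideal_prod_mono[OF adjoin_superset order_refl])
  then show ?thesis
    by (simp add: ideal_pow_Suc ideal_prod_commute[OF adjoin_ideal adjoin_pow_ideal])
qed

lemma lower_forms_absorb: "ideal_pow R adjoined d \<cdot> lforms e = lforms (d + e)"
proof -
  have "ideal_pow R adjoined d \<cdot> lforms e = (I \<cdot> ideal_pow R adjoined d) \<cdot> ideal_pow R adjoined e"
    unfolding lower_forms_def
    by (simp add: ideal_prod_assoc[symmetric] ideal_prod_commute I adjoin_pow_ideal)
  also have "\<dots> = lforms (d + e)"
    by (simp add: lower_forms_def ideal_prod_assoc I adjoin_pow_ideal ideal_pow_add adjoin_ideal)
  finally show ?thesis .
qed

lemma lower_forms_mult:
  assumes "a \<in> ideal_pow R adjoined d" "l \<in> lforms e"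
  shows "a \<otimes> l \<in> lforms (d + e)"
  using ideal_prod.prod[OF assms, of R] by (simp add: lower_forms_absorb)

lemma lower_forms_prod_mult:
  assumes "ideal P R" "a \<in> ideal_pow R adjoined d" "y \<in> lforms e \<cdot> P"
  shows "a \<otimes> y \<in> lforms (d + e) \<cdot> P"
proof -
  have "a \<otimes> y \<in> ideal_pow R adjoined d \<cdot> (lforms e \<cdot> P)" using assms by (intro ideal_prod.prod)
  then show ?thesis
    by (simp add: ideal_prod_assoc[symmetric] adjoin_pow_ideal lower_forms_ideal assms(1)
        lower_forms_absorb)
qed

lemma monic_forms_subset: "monic_forms I x d \<subseteq> ideal_pow R adjoined (Suc d)"
  unfolding monic_forms_def
  using lower_forms_subset pow_mem_ideal_pow[OF adjoin_self]
    additive_subgroup.a_closed[OF ideal.axioms(1)[OF adjoin_pow_ideal]] by blast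

lemma monic_forms_carrier: "c \<in> monic_forms I x d \<Longrightarrow> c \<in> carrier R"
  using monic_forms_subset ideal.Icarr[OF adjoin_pow_ideal] by blast

lemma monic_forms_diff:
  assumes "c \<in> monic_forms I x d" "l \<in> lforms d"
  shows "c \<ominus> l \<in> monic_forms I x d"
proof -
  obtain m where m: "m \<in> lforms d" "c = x [^] Suc d \<oplus> m" using assms(1) unfolding monic_forms_def by blast
  have "c \<ominus> l = x [^] Suc d \<oplus> (m \<ominus> l)"
    using m assms(2) x ideal.Icarr[OF lower_forms_ideal] unfolding a_minus_def
    by (simp add: a_assoc del: nat_pow_Suc)
  then show ?thesis
    unfolding monic_forms_def using ideal_sub_closed[OF lower_forms_ideal m(1) assms(2)] by blast
qed

text \<open>The degrees \<open>d + 1\<close> and \<open>e + 1\<close> add up to \<open>(d + e + 1) + 1\<close>.\<close>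

lemma monic_forms_mult:
  assumes b: "b \<in> monic_forms I x d" and c: "c \<in> monic_forms I x e"
  shows "b \<otimes> c \<in> monic_forms I x (Suc (d + e))"
proof -
  obtain l where l: "l \<in> lforms d" "b = x [^] Suc d \<oplus> l" using b unfolding monic_forms_def by blast
  obtain m where m: "m \<in> lforms e" "c = x [^] Suc e \<oplus> m" using c unfolding monic_forms_def by blast
  have cl: "l \<in> carrier R" "m \<in> carrier R" "b \<in> carrier R"
    using l m b ideal.Icarr[OF lower_forms_ideal] monic_forms_carrier by auto
  have "x [^] Suc e \<otimes> l \<in> lforms (Suc e + d)"
    using lower_forms_mult[OF pow_mem_ideal_pow[OF adjoin_self] l(1)] .
  moreover have "b \<otimes> m \<in> lforms (Suc d + e)"
    using b monic_forms_subset by (blast intro: lower_forms_mult[OF _ m(1)])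
  ultimately have "x [^] Suc e \<otimes> l \<oplus> b \<otimes> m \<in> lforms (Suc (d + e))"
    using additive_subgroup.a_closed[OF ideal.axioms(1)[OF lower_forms_ideal]]
    by (simp add: add.commute del: nat_pow_Suc)
  moreover have "b \<otimes> c = x [^] Suc (Suc (d + e)) \<oplus> (x [^] Suc e \<otimes> l \<oplus> b \<otimes> m)"
  proof -
    have p: "x [^] Suc d \<otimes> x [^] Suc e = x [^] Suc (Suc (d + e))"
      unfolding nat_pow_mult[OF x] by simp
    have xc: "x [^] Suc d \<in> carrier R" "x [^] Suc e \<in> carrier R" using x by auto
    have "b \<otimes> c = (x [^] Suc d \<oplus> l) \<otimes> x [^] Suc e \<oplus> b \<otimes> m"
      using cl xc unfolding m(2) l(2)[symmetric] by (simp add: r_distr del: nat_pow_Suc)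
    also have "\<dots> = x [^] Suc d \<otimes> x [^] Suc e \<oplus> (x [^] Suc e \<otimes> l \<oplus> b \<otimes> m)"
      using cl xc by (simp add: l_distr m_comm[of l] a_assoc del: nat_pow_Suc)
    finally show ?thesis unfolding p .
  qed
  ultimately show ?thesis unfolding monic_forms_def by blast
qed

lemma lower_forms_step: "lforms (Suc d) = lforms d \<cdot> adjoined"
  by (simp add: lower_forms_def ideal_pow_Suc ideal_prod_assoc I adjoin_pow_ideal adjoin_ideal)

text \<open>A form without leading term is \<open>x\<close> times such a form of one degree less, plus its last coefficient:
  iterating this identity lists the coefficients. It holds by induction because
  \<open>I (I, x)\<^sup>d\<^sup>+\<^sup>1 = I (I, x)\<^sup>d I + x I (I, x)\<^sup>d\<close>.\<close>

lemma lower_forms_Suc: "lforms (Suc d) \<subseteq> set_add R ((PIdl x) \<cdot> lforms d) (ideal_pow R I (Suc (Suc d)))"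
proof (induction d)
  case 0
  show ?case unfolding lower_forms_step[of 0]
  proof (rule ideal_prod_subsetI)
    show "ideal (set_add R ((PIdl x) \<cdot> lforms 0) (ideal_pow R I (Suc (Suc 0)))) R"
      by (intro add_ideals ideal_prod_is_ideal cgenideal_ideal x lower_forms_ideal ideal_pow_ideal I)
    fix l y assume l: "l \<in> lforms 0" and "y \<in> adjoined"
    then obtain a r where a: "a \<in> I" "r \<in> carrier R" "y = a \<oplus> r \<otimes> x" by (blast elim: adjoin_cases)
    have cl: "l \<in> carrier R" "a \<in> carrier R" using l a ideal.Icarr[OF I] lower_forms_0 by auto
    have "l \<otimes> a \<in> ideal_pow R I (Suc (Suc 0))"
      using l a by (simp add: lower_forms_0 ideal_pow_Suc[of _ "Suc 0"] ideal_pow_1 I ideal_prod.prod)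
    moreover have "r \<otimes> x \<otimes> l \<in> (PIdl x) \<cdot> lforms 0"
      using a l by (intro ideal_prod.prod) (auto simp: cgenideal_def)
    moreover have "l \<otimes> y = r \<otimes> x \<otimes> l \<oplus> l \<otimes> a" using cl a x by algebra
    ultimately show "l \<otimes> y \<in> set_add R ((PIdl x) \<cdot> lforms 0) (ideal_pow R I (Suc (Suc 0)))"
      unfolding set_add_def' by blast
  qed
next
  case (Suc d)
  show ?case unfolding lower_forms_step[of "Suc d"]
  proof (rule ideal_prod_subsetI)
    show "ideal (set_add R ((PIdl x) \<cdot> lforms (Suc d)) (ideal_pow R I (Suc (Suc (Suc d))))) R"
      by (intro add_ideals ideal_prod_is_ideal cgenideal_ideal x lower_forms_ideal ideal_pow_ideal I)
    fix l y assume l: "l \<in> lforms (Suc d)" and "y \<in> adjoined"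
    then obtain a r where a: "a \<in> I" "r \<in> carrier R" "y = a \<oplus> r \<otimes> x" by (blast elim: adjoin_cases)
    obtain u v where uv: "u \<in> (PIdl x) \<cdot> lforms d" "v \<in> ideal_pow R I (Suc (Suc d))" "l = u \<oplus> v"
      using l Suc unfolding set_add_def' by blast
    have cl: "l \<in> carrier R" "a \<in> carrier R" "u \<in> carrier R" "v \<in> carrier R"
      using l a uv ideal.Icarr[OF I] ideal.Icarr[OF lower_forms_ideal] ideal.Icarr[OF ideal_pow_ideal[OF I]]
        subsetD[OF ideal_prod_in_carrier[OF cgenideal_ideal[OF x] lower_forms_ideal]] by auto
    have "v \<otimes> a \<in> ideal_pow R I (Suc (Suc (Suc d)))"
      using uv a by (simp only: ideal_pow_Suc[of _ "Suc (Suc d)"] ideal_prod.prod)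
    moreover have "u \<otimes> a \<oplus> r \<otimes> x \<otimes> l \<in> (PIdl x) \<cdot> lforms (Suc d)"
    proof (rule ideal_prod.sum)
      have "u \<otimes> a \<in> ((PIdl x) \<cdot> lforms d) \<cdot> adjoined"
        using uv a adjoin_superset by (intro ideal_prod.prod) auto
      then show "u \<otimes> a \<in> (PIdl x) \<cdot> lforms (Suc d)"
        by (simp add: lower_forms_step ideal_prod_assoc cgenideal_ideal x lower_forms_ideal adjoin_ideal)
      show "r \<otimes> x \<otimes> l \<in> (PIdl x) \<cdot> lforms (Suc d)"
        using a l by (intro ideal_prod.prod) (auto simp: cgenideal_def)
    qed
    moreover have "l \<otimes> y = (u \<otimes> a \<oplus> r \<otimes> x \<otimes> l) \<oplus> v \<otimes> a"
    proof -
      have "l \<otimes> y = l \<otimes> a \<oplus> r \<otimes> x \<otimes> l" using cl a x by algebra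
      also have "l \<otimes> a = u \<otimes> a \<oplus> v \<otimes> a" using cl uv by algebra
      also have "u \<otimes> a \<oplus> v \<otimes> a \<oplus> r \<otimes> x \<otimes> l = (u \<otimes> a \<oplus> r \<otimes> x \<otimes> l) \<oplus> v \<otimes> a"
        using cl a x by algebra
      finally show ?thesis .
    qed
    ultimately show "l \<otimes> y \<in> set_add R ((PIdl x) \<cdot> lforms (Suc d)) (ideal_pow R I (Suc (Suc (Suc d))))"
      unfolding set_add_def' by blast
  qed
qed

lemma lower_forms_expand:
  assumes "z \<in> lforms d"
  shows "\<exists>a. (\<forall>i \<in> {1..Suc d}. a i \<in> ideal_pow R I i) \<and>
    z = (\<Oplus>i \<in> {1..Suc d}. a i \<otimes> x [^] (Suc d - i))"
  using assms
proof (induction d arbitrary: z)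
  case 0
  then have "z \<in> I" "z \<in> carrier R" using ideal.Icarr[OF I] by (auto simp: lower_forms_0)
  then show ?case by (intro exI[of _ "\<lambda>_. z"]) (simp add: ideal_pow_1[OF I])
next
  case (Suc d)
  then obtain u v where uv: "u \<in> (PIdl x) \<cdot> lforms d" "v \<in> ideal_pow R I (Suc (Suc d))" "z = u \<oplus> v"
    using lower_forms_Suc unfolding set_add_def' by blast
  obtain l where l: "l \<in> lforms d" "u = l \<otimes> x"
    using uv(1) principal_ideal_prod_cases[OF lower_forms_ideal x]
    by (auto simp: ideal_prod_commute[OF cgenideal_ideal[OF x] lower_forms_ideal])
  obtain a where a: "\<And>i. i \<in> {1..Suc d} \<Longrightarrow> a i \<in> ideal_pow R I i"
      "l = (\<Oplus>i \<in> {1..Suc d}. a i \<otimes> x [^] (Suc d - i))"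
    using Suc.IH[OF l(1)] by blast
  define b where "b = a(Suc (Suc d) := v)"
  have ac: "a i \<in> carrier R" if "i \<in> {1..Suc d}" for i
    using a(1)[OF that] ideal.Icarr[OF ideal_pow_ideal[OF I]] by blast
  have vc: "v \<in> carrier R" using uv ideal.Icarr[OF ideal_pow_ideal[OF I]] by blast
  have uc: "u \<in> carrier R" using l x ideal.Icarr[OF lower_forms_ideal] by simp
  have "u = (\<Oplus>i \<in> {1..Suc d}. a i \<otimes> x [^] (Suc d - i) \<otimes> x)"
    unfolding l(2) a(2) using ac x by (intro finsum_ldistr) auto
  also have "\<dots> = (\<Oplus>i \<in> {1..Suc d}. b i \<otimes> x [^] (Suc (Suc d) - i))"
  proof (rule finsum_cong')
    fix i assume i: "i \<in> {1..Suc d}"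
    then have "a i \<otimes> x [^] (Suc d - i) \<otimes> x = a i \<otimes> x [^] Suc (Suc d - i)"
      using ac x by (simp add: m_assoc)
    also have "Suc (Suc d - i) = Suc (Suc d) - i" using i by auto
    finally show "a i \<otimes> x [^] (Suc d - i) \<otimes> x = b i \<otimes> x [^] (Suc (Suc d) - i)"
      using i by (simp add: b_def)
  qed (use ac x in \<open>auto simp: b_def\<close>)
  finally have "z = v \<oplus> (\<Oplus>i \<in> {1..Suc d}. b i \<otimes> x [^] (Suc (Suc d) - i))"
    using uv(3) uc vc by (simp add: a_comm)
  also have "\<dots> = (\<Oplus>i \<in> {1..Suc (Suc d)}. b i \<otimes> x [^] (Suc (Suc d) - i))"
    using vc ac x by (subst atLeastAtMostSuc_conv[of 1 "Suc d"]) (auto simp: b_def)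
  finally have "z = (\<Oplus>i \<in> {1..Suc (Suc d)}. b i \<otimes> x [^] (Suc (Suc d) - i))" .
  moreover have "\<forall>i \<in> {1..Suc (Suc d)}. b i \<in> ideal_pow R I i"
    using a(1) uv(2) by (auto simp: b_def)
  ultimately show ?case by blast
qed

section \<open>Integral dependence and multipliers of regular ideals\<close>

text \<open>Equations of integral dependence translated into ideals: with \<open>n = d + 1\<close>, the equation says
  that \<open>x\<^sup>n\<close> is a form without leading term.\<close>

lemma integral_closure_iff_pow_mem:
  "x \<in> integral_closure R I \<longleftrightarrow> (\<exists>d. x [^] Suc d \<in> lforms d)"
proof
  assume "x \<in> integral_closure R I"
  then obtain n a where n: "1 \<le> n" and a: "\<And>i. i \<in> {1..n} \<Longrightarrow> a i \<in> ideal_pow R I i"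
    and eq: "x [^] n \<oplus> (\<Oplus>i \<in> {1..n}. a i \<otimes> x [^] (n - i)) = \<zero>"
    unfolding integral_closure_def by blast
  obtain d where d: "n = Suc d" using n by (cases n) auto
  have "a i \<otimes> x [^] (n - i) \<in> lforms d" if i: "i \<in> {1..n}" for i
  proof -
    obtain j where j: "i = Suc j" using i by (cases i) auto
    have "a i \<in> I \<cdot> ideal_pow R I j"
      using a[OF i] by (simp add: j ideal_pow_Suc ideal_prod_commute[OF I ideal_pow_ideal[OF I]])
    also have "\<dots> \<subseteq> lforms j"
      unfolding lower_forms_def by (intro ideal_prod_mono ideal_pow_mono order_refl adjoin_superset)
    finally have "x [^] (n - i) \<otimes> a i \<in> lforms (n - i + j)"
      by (intro lower_forms_mult pow_mem_ideal_pow adjoin_self)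
    moreover have "a i \<in> carrier R" using a[OF i] ideal.Icarr[OF ideal_pow_ideal[OF I]] by blast
    moreover have "n - i + j = d" using i d j by auto
    ultimately show ?thesis using x by (simp add: m_comm)
  qed
  then have s: "(\<Oplus>i \<in> {1..n}. a i \<otimes> x [^] (n - i)) \<in> lforms d"
    by (rule ideal_finsum_closed[OF lower_forms_ideal])
  have sc: "(\<Oplus>i \<in> {1..n}. a i \<otimes> x [^] (n - i)) \<in> carrier R"
    by (rule ideal.Icarr[OF lower_forms_ideal s])
  have "x [^] n = \<ominus> (\<Oplus>i \<in> {1..n}. a i \<otimes> x [^] (n - i))"
    by (rule minus_equality[OF eq sc, symmetric]) (use x in simp)
  then have "x [^] n \<in> lforms d"
    using additive_subgroup.a_inv_closed[OF ideal.axioms(1)[OF lower_forms_ideal] s] by simp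
  then show "\<exists>d. x [^] Suc d \<in> lforms d" unfolding d by blast
next
  assume "\<exists>d. x [^] Suc d \<in> lforms d"
  then obtain d where d: "x [^] Suc d \<in> lforms d" by blast
  then have "\<ominus> (x [^] Suc d) \<in> lforms d"
    by (rule additive_subgroup.a_inv_closed[OF ideal.axioms(1)[OF lower_forms_ideal]])
  then obtain a where a: "\<forall>i \<in> {1..Suc d}. a i \<in> ideal_pow R I i"
      "\<ominus> (x [^] Suc d) = (\<Oplus>i \<in> {1..Suc d}. a i \<otimes> x [^] (Suc d - i))"
    using lower_forms_expand by blast
  have "x [^] Suc d \<oplus> (\<Oplus>i \<in> {1..Suc d}. a i \<otimes> x [^] (Suc d - i)) = \<zero>"
    unfolding a(2)[symmetric] by (rule r_neg) (use x in simp)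
  then show "x \<in> integral_closure R I"
    unfolding integral_closure_def using a(1) x by (intro CollectI conjI exI[of _ "Suc d"] exI[of _ a]) auto
qed

text \<open>The monomials of degree \<open>d + 1\<close> in \<open>x\<close> and elements of \<open>I\<close> are the pure power \<open>x\<^sup>d\<^sup>+\<^sup>1\<close> and monomials
  with a factor from \<open>I\<close>.\<close>

lemma adjoin_pow_Suc_subset:
  "ideal_pow R adjoined (Suc d) \<subseteq> set_add R (lforms d) (PIdl (x [^] Suc d))"
proof (induction d)
  case 0
  show ?case using x by (simp add: ideal_pow_1 adjoin_ideal lower_forms_0)
next
  case (Suc d)
  let ?T = "set_add R (lforms (Suc d)) (PIdl (x [^] Suc (Suc d)))"
  have xc: "x [^] Suc d \<in> carrier R" "x [^] Suc (Suc d) \<in> carrier R" using x by auto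
  show ?case unfolding ideal_pow_Suc[of _ "Suc d"]
  proof (rule ideal_prod_subsetI)
    show "ideal ?T R" by (intro add_ideals lower_forms_ideal cgenideal_ideal xc)
    fix u y assume "u \<in> ideal_pow R adjoined (Suc d)" and y: "y \<in> adjoined"
    then obtain l r where l: "l \<in> lforms d" "r \<in> carrier R" "u = l \<oplus> r \<otimes> x [^] Suc d"
      using Suc unfolding set_add_def' cgenideal_def by blast
    obtain a q where a: "a \<in> I" "q \<in> carrier R" "y = a \<oplus> q \<otimes> x" using y by (blast elim: adjoin_cases)
    have cl: "l \<in> carrier R" "a \<in> carrier R" "y \<in> carrier R"
      using l a y ideal.Icarr[OF I] ideal.Icarr[OF lower_forms_ideal] ideal.Icarr[OF adjoin_ideal] by auto
    have "r \<otimes> x [^] Suc d \<in> ideal_pow R adjoined (Suc d)"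
      using l pow_mem_ideal_pow[OF adjoin_self] by (intro ideal.I_l_closed[OF adjoin_pow_ideal])
    then have "a \<otimes> (r \<otimes> x [^] Suc d) \<in> lforms (Suc d)"
      unfolding lower_forms_def using a by (intro ideal_prod.prod)
    moreover have "l \<otimes> y \<in> lforms (Suc d)"
      unfolding lower_forms_step using l y by (intro ideal_prod.prod)
    ultimately have "l \<otimes> y \<oplus> a \<otimes> (r \<otimes> x [^] Suc d) \<in> lforms (Suc d)"
      by (intro additive_subgroup.a_closed[OF ideal.axioms(1)[OF lower_forms_ideal]])
    moreover have "r \<otimes> q \<otimes> x [^] Suc (Suc d) \<in> PIdl (x [^] Suc (Suc d))"
      using l a by (auto simp: cgenideal_def)
    moreover have "u \<otimes> y = (l \<otimes> y \<oplus> a \<otimes> (r \<otimes> x [^] Suc d)) \<oplus> r \<otimes> q \<otimes> x [^] Suc (Suc d)"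
    proof -
      have "u \<otimes> y = l \<otimes> y \<oplus> (r \<otimes> x [^] Suc d) \<otimes> (a \<oplus> q \<otimes> x)"
        using cl l xc by (simp add: l_distr a(3)[symmetric] del: nat_pow_Suc)
      also have "(r \<otimes> x [^] Suc d) \<otimes> (a \<oplus> q \<otimes> x) = a \<otimes> (r \<otimes> x [^] Suc d) \<oplus> r \<otimes> q \<otimes> (x [^] Suc d \<otimes> x)"
        using cl(2) l(2) a(2) x xc(1) by algebra
      finally show ?thesis using cl l a x xc by (simp add: a_assoc)
    qed
    ultimately show "u \<otimes> y \<in> ?T" unfolding set_add_def' by blast
  qed
qed

text \<open>Once \<open>x\<^sup>d\<^sup>+\<^sup>1\<close> lies in \<open>I (I, x)\<^sup>d\<close>, so does all of \<open>(I, x)\<^sup>d\<^sup>+\<^sup>1\<close>; that is, \<open>I\<close> is a reduction of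
  \<open>(I, x)\<close>.\<close>

lemma integral_imp_reduction:
  assumes "x [^] Suc d \<in> lforms d" "y \<in> ideal_pow R adjoined d"
  shows "x \<otimes> y \<in> I \<cdot> ideal_pow R adjoined d"
proof -
  have "y \<otimes> x \<in> ideal_pow R adjoined (Suc d)"
    unfolding ideal_pow_Suc using assms(2) adjoin_self by (intro ideal_prod.prod)
  then have "x \<otimes> y \<in> ideal_pow R adjoined (Suc d)"
    using x ideal.Icarr[OF adjoin_pow_ideal assms(2)] by (simp add: m_comm)
  moreover have "set_add R (lforms d) (PIdl (x [^] Suc d)) \<subseteq> lforms d"
    using cgenideal_minimal[OF lower_forms_ideal assms(1)]
      additive_subgroup.a_closed[OF ideal.axioms(1)[OF lower_forms_ideal]]
    unfolding set_add_def' by blast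
  ultimately show ?thesis using adjoin_pow_Suc_subset by (auto simp: lower_forms_def)
qed

text \<open>Elimination of one generator at a time replaces the determinant. Write \<open>L\<close> for the forms without
  leading term of the degree of \<open>c\<close>, and let the ideal be \<open>(n) + P\<close>. From
  \<open>c n = l n + y\<close> with \<open>l \<in> L\<close> and \<open>y \<in> L P\<close>, the monic form \<open>b = c - l\<close> satisfies \<open>b n = y \<in> L P\<close>.
  For \<open>u \<in> P\<close> with \<open>c u = m n + z\<close> this gives \<open>b c u = m y + b z\<close>, from which \<open>n\<close> has disappeared:
  \<open>b c\<close> satisfies the hypothesis for \<open>P\<close>. A monic form \<open>c'\<close> annihilating \<open>P\<close> also annihilates
  \<open>b n = y \<in> P\<close>, hence \<open>c' b\<close> annihilates \<open>(n) + P\<close>. Working with forms instead of polynomials keeps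
  the \<open>i\<close>-th coefficient in \<open>I\<^sup>i\<close>, which integrality over an ideal requires.\<close>

lemma determinant_trick:
  assumes "finite S" "S \<subseteq> carrier R" "c \<in> monic_forms I x d"
    and "\<And>u. u \<in> Idl S \<Longrightarrow> c \<otimes> u \<in> lforms d \<cdot> (Idl S)"
  shows "\<exists>e. \<exists>c' \<in> monic_forms I x e. \<forall>u \<in> Idl S. c' \<otimes> u = \<zero>"
  using assms
proof (induction S arbitrary: c d rule: finite_induct)
  case empty
  have "Idl {} \<subseteq> {\<zero>}" by (intro genideal_minimal zeroideal) simp
  then show ?case using empty monic_forms_carrier[OF empty(2)] by force
next
  case (insert n S)
  let ?P = "Idl S"
  have n: "n \<in> carrier R" and S: "S \<subseteq> carrier R" using insert by auto
  have P: "ideal ?P R" by (rule genideal_ideal[OF S])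
  have nP: "ideal (PIdl n) R" by (rule cgenideal_ideal[OF n])
  note [simp] = monic_forms_carrier ideal.Icarr[OF P] ideal.Icarr[OF lower_forms_ideal]
    ideal.Icarr[OF ideal_prod_is_ideal[OF lower_forms_ideal P]]
  note gen = genideal_insert[OF n S]
  have split: "\<exists>l \<in> lforms d. \<exists>y \<in> lforms d \<cdot> ?P. c \<otimes> u = l \<otimes> n \<oplus> y" if "u \<in> Idl (insert n S)" for u
  proof -
    have "c \<otimes> u \<in> set_add R (lforms d \<cdot> (PIdl n)) (lforms d \<cdot> ?P)"
      using insert.prems(3)[OF that] by (simp add: gen ideal_prod_distr(1) lower_forms_ideal nP P)
    then obtain z y where "z \<in> lforms d \<cdot> (PIdl n)" "y \<in> lforms d \<cdot> ?P" "c \<otimes> u = z \<oplus> y"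
      unfolding set_add_def' by blast
    then show ?thesis using principal_ideal_prod_cases[OF lower_forms_ideal n] by blast
  qed
  have self: "insert n S \<subseteq> Idl (insert n S)" by (rule genideal_self[OF insert.prems(1)])
  then have sub: "?P \<subseteq> Idl (insert n S)"
    by (intro genideal_minimal[OF genideal_ideal[OF insert.prems(1)]]) blast
  have "n \<in> Idl (insert n S)" using self by simp
  from split[OF this]
  obtain l y where l: "l \<in> lforms d" and y: "y \<in> lforms d \<cdot> ?P" and cn: "c \<otimes> n = l \<otimes> n \<oplus> y"
    by (elim bexE) (rule that)
  define b where "b = c \<ominus> l"
  have b: "b \<in> monic_forms I x d" unfolding b_def by (rule monic_forms_diff[OF insert.prems(2) l])
  have bn: "b \<otimes> n = y"
  proof -
    have "b \<otimes> n = c \<otimes> n \<ominus> l \<otimes> n" unfolding b_def using insert.prems(2) l n by (simp add: a_minus_def l_distr l_minus)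
    also have "\<dots> = y" unfolding cn using l y n by (simp add: a_minus_def a_comm[of "l \<otimes> n"] a_assoc r_neg)
    finally show ?thesis .
  qed
  have "(b \<otimes> c) \<otimes> u \<in> lforms (Suc (d + d)) \<cdot> ?P" if u: "u \<in> ?P" for u
  proof -
    obtain m z where m: "m \<in> lforms d" and z: "z \<in> lforms d \<cdot> ?P" and cu: "c \<otimes> u = m \<otimes> n \<oplus> z"
      using split[OF subsetD[OF sub u]] by (elim bexE) (rule that)
    have "(b \<otimes> c) \<otimes> u = m \<otimes> y \<oplus> b \<otimes> z"
    proof -
      have "(b \<otimes> c) \<otimes> u = b \<otimes> (m \<otimes> n \<oplus> z)" using b insert.prems(2) u by (simp add: m_assoc cu)
      also have "\<dots> = m \<otimes> (b \<otimes> n) \<oplus> b \<otimes> z" using b m n z by (simp add: r_distr m_lcomm)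
      finally show ?thesis by (simp add: bn)
    qed
    moreover have "m \<otimes> y \<in> lforms (Suc d + d) \<cdot> ?P" "b \<otimes> z \<in> lforms (Suc d + d) \<cdot> ?P"
      using m b lower_forms_subset monic_forms_subset
      by (blast intro: lower_forms_prod_mult[OF P _ y] lower_forms_prod_mult[OF P _ z])+
    ultimately show ?thesis by (simp add: ideal_prod.sum)
  qed
  then have "\<exists>e. \<exists>c' \<in> monic_forms I x e. \<forall>u \<in> ?P. c' \<otimes> u = \<zero>"
    by (rule insert.IH[OF S monic_forms_mult[OF b insert.prems(2)]])
  then obtain e c' where c': "c' \<in> monic_forms I x e" "\<And>u. u \<in> ?P \<Longrightarrow> c' \<otimes> u = \<zero>"
    by (elim exE bexE) (rule that, assumption, erule (1) bspec)
  have "(c' \<otimes> b) \<otimes> u = \<zero>" if uI: "u \<in> Idl (insert n S)" for u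
  proof -
    obtain r v where r: "r \<in> carrier R" and v: "v \<in> ?P" and u: "u = r \<otimes> n \<oplus> v"
      using uI unfolding gen set_add_def' cgenideal_def by blast
    have c'y: "c' \<otimes> y = \<zero>"
      using subsetD[OF ideal_prod_inter[OF lower_forms_ideal P] y] by (intro c'(2)) simp
    have "(c' \<otimes> b) \<otimes> u = r \<otimes> (c' \<otimes> (b \<otimes> n)) \<oplus> b \<otimes> (c' \<otimes> v)"
      unfolding u using monic_forms_carrier[OF b] monic_forms_carrier[OF c'(1)] r n ideal.Icarr[OF P v]
      by algebra
    then show ?thesis using b r v by (simp add: bn c'y c'(2))
  qed
  then show ?case using monic_forms_mult[OF c'(1) b] by blast
qed

end

lemma integral_closure_carrier: "x \<in> integral_closure R I \<Longrightarrow> x \<in> carrier R"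
  by (simp add: integral_closure_def)

text \<open>The ideal is \<open>(I, x)\<^sup>d\<close>, regular because it contains \<open>I\<^sup>d\<close>.\<close>

lemma integral_imp_regular_multiplier:
  assumes "regular_ideal I R" "x \<in> integral_closure R I"
  shows "\<exists>N. regular_ideal N R \<and> (\<forall>y \<in> N. x \<otimes> y \<in> I \<cdot> N)"
proof -
  have I: "ideal I R" using assms by (simp add: regular_ideal_def)
  have x: "x \<in> carrier R" using assms(2) by (rule integral_closure_carrier)
  obtain d where "x [^] Suc d \<in> lower_forms I x d"
    using assms(2) integral_closure_iff_pow_mem[OF I x] by blast
  moreover have "regular_ideal (set_add R I (PIdl x)) R"
    by (rule regular_ideal_superset[OF assms(1) adjoin_ideal[OF I x] adjoin_superset[OF I x]])
  ultimately show ?thesis using integral_imp_reduction[OF I x] regular_ideal_pow by blast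
qed

text \<open>The determinant trick starts from the monic form \<open>x\<close> of degree \<open>1\<close>. The monic form that it
  returns annihilates a nonzerodivisor in \<open>N\<close>, so it is zero.\<close>

lemma regular_multiplier_imp_integral:
  assumes I: "ideal I R" and x: "x \<in> carrier R" and N: "regular_ideal N R"
    and fg: "finite S" "S \<subseteq> carrier R" "N = Idl S" and mult: "\<And>y. y \<in> N \<Longrightarrow> x \<otimes> y \<in> I \<cdot> N"
  shows "x \<in> integral_closure R I"
proof -
  have "x = x [^] Suc 0 \<oplus> \<zero>" "\<zero> \<in> lower_forms I x 0"
    using x additive_subgroup.zero_closed[OF ideal.axioms(1)[OF lower_forms_ideal[OF I x]]] by simp_all
  then have "x \<in> monic_forms I x 0" unfolding monic_forms_def by blast
  then obtain e c where c: "c \<in> monic_forms I x e" "\<forall>u \<in> N. c \<otimes> u = \<zero>"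
    using determinant_trick[OF I x fg(1,2), of x 0] mult
    unfolding fg(3)[symmetric] lower_forms_0[OF I x] by blast
  obtain s where "s \<in> N" "s \<in> nonzerodivisors R" using N by (auto simp: regular_ideal_def)
  then have "c = \<zero>" using c nzdD monic_forms_carrier[OF I x c(1)] by blast
  then obtain l where l: "l \<in> lower_forms I x e" "x [^] Suc e \<oplus> l = \<zero>"
    using c(1) unfolding monic_forms_def by auto
  have "x [^] Suc e = \<ominus> l"
    by (rule minus_equality[OF l(2), symmetric]) (use x ideal.Icarr[OF lower_forms_ideal[OF I x] l(1)] in auto)
  then have "x [^] Suc e \<in> lower_forms I x e"
    using additive_subgroup.a_inv_closed[OF ideal.axioms(1)[OF lower_forms_ideal[OF I x]] l(1)] by simp
  then show ?thesis using integral_closure_iff_pow_mem[OF I x] by blast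
qed

lemma multiplier_prod_left:
  assumes "ideal I R" "ideal N R" "ideal N' R" "x \<in> carrier R" "\<And>y. y \<in> N \<Longrightarrow> x \<otimes> y \<in> I \<cdot> N"
    and "y \<in> N \<cdot> N'"
  shows "x \<otimes> y \<in> I \<cdot> (N \<cdot> N')"
proof (rule ideal_prod_scaled_mem[OF assms(2,3) _ assms(4) _ assms(6)])
  show "ideal (I \<cdot> (N \<cdot> N')) R" using assms by (intro ideal_prod_is_ideal)
  fix i j assume ij: "i \<in> N" "j \<in> N'"
  have "(x \<otimes> i) \<otimes> j \<in> (I \<cdot> N) \<cdot> N'" by (rule ideal_prod.prod[OF assms(5)[OF ij(1)] ij(2)])
  then show "x \<otimes> (i \<otimes> j) \<in> I \<cdot> (N \<cdot> N')"
    using assms(4) ideal.Icarr[OF assms(2) ij(1)] ideal.Icarr[OF assms(3) ij(2)]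
    by (simp add: ideal_prod_assoc[OF assms(1-3)] m_assoc)
qed

text \<open>Multipliers of \<open>N\<close> into \<open>I N\<close> remain so for \<open>N N'\<close>, so the product of the regular ideals
  belonging to the single elements works for all of them.\<close>

lemma integral_set_common_multiplier:
  assumes I: "regular_ideal I R" and "finite S" "S \<subseteq> integral_closure R I"
  shows "\<exists>N. regular_ideal N R \<and> (\<forall>x \<in> S. \<forall>y \<in> N. x \<otimes> y \<in> I \<cdot> N)"
  using assms(2,3)
proof (induction S rule: finite_induct)
  case empty
  then show ?case using I by blast
next
  case (insert x S)
  obtain N where N: "regular_ideal N R" "\<forall>x \<in> S. \<forall>y \<in> N. x \<otimes> y \<in> I \<cdot> N" using insert by auto
  obtain N' where N': "regular_ideal N' R" "\<forall>y \<in> N'. x \<otimes> y \<in> I \<cdot> N'"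
    using integral_imp_regular_multiplier[OF I, of x] insert by auto
  have id: "ideal I R" "ideal N R" "ideal N' R" using I N N' by (auto simp: regular_ideal_def)
  have "z \<otimes> y \<in> I \<cdot> (N \<cdot> N')" if z: "z \<in> insert x S" and y: "y \<in> N \<cdot> N'" for z y
  proof (cases "z \<in> S")
    case True
    then show ?thesis
      using multiplier_prod_left[OF id, of z y] y N insert.prems integral_closure_carrier by auto
  next
    case False
    then have "z = x" using z by simp
    then show ?thesis
      using multiplier_prod_left[OF id(1,3,2), of x y] y N' insert.prems integral_closure_carrier
      by (auto simp: ideal_prod_commute[OF id(2,3)])
  qed
  then show ?case using regular_ideal_prod[OF N(1) N'(1)] by blast
qed

end

section \<open>The integral closure over a Noetherian ring\<close>

lemma (in noetherian_ring) regular_multiplier_integral: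
  assumes "cring R" "ideal I R" "regular_ideal N R" "x \<in> carrier R" "\<And>y. y \<in> N \<Longrightarrow> x \<otimes> y \<in> I \<cdot> N"
  shows "x \<in> integral_closure R I"
proof -
  interpret cring R by fact
  obtain S where "S \<subseteq> carrier R" "finite S" "N = Idl S"
    using finetely_gen assms(3) unfolding regular_ideal_def by blast
  then show ?thesis using assms by (intro regular_multiplier_imp_integral[of I x N S]) auto
qed

text \<open>The ideal is \<open>{x. x N \<subseteq> I N}\<close> for a regular ideal \<open>N\<close> that works for all of \<open>T\<close>.\<close>

lemma (in noetherian_ring) integral_closure_directed:
  assumes "cring R" and I: "regular_ideal I R" and T: "finite T" "T \<subseteq> integral_closure R I"
  obtains K where "ideal K R" "T \<subseteq> K" "K \<subseteq> integral_closure R I"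
proof -
  interpret cring R by fact
  obtain N where N: "regular_ideal N R" "\<forall>x \<in> T. \<forall>y \<in> N. x \<otimes> y \<in> I \<cdot> N"
    using integral_set_common_multiplier[OF I T] by (elim exE conjE) (rule that)
  have id: "ideal I R" "ideal N R" using I N(1) by (simp_all add: regular_ideal_def)
  show thesis
  proof (rule that)
    show "ideal {x \<in> carrier R. \<forall>y \<in> N. x \<otimes> y \<in> I \<cdot> N} R"
      by (intro ideal_multiplier ideal_prod_is_ideal id)
    show "T \<subseteq> {x \<in> carrier R. \<forall>y \<in> N. x \<otimes> y \<in> I \<cdot> N}"
      using N(2) T(2) integral_closure_carrier by blast
    show "{x \<in> carrier R. \<forall>y \<in> N. x \<otimes> y \<in> I \<cdot> N} \<subseteq> integral_closure R I"
    proof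
      fix x assume "x \<in> {x \<in> carrier R. \<forall>y \<in> N. x \<otimes> y \<in> I \<cdot> N}"
      then show "x \<in> integral_closure R I"
        by (intro regular_multiplier_integral[OF assms(1) id(1) N(1)]) simp_all
    qed
  qed
qed

text \<open>A directed union of ideals is an ideal, and each operation involves at most two elements of it.\<close>

lemma (in noetherian_ring) integral_closure_ideal:
  assumes R: "cring R" and I: "regular_ideal I R"
  shows "ideal (integral_closure R I) R"
proof -
  interpret cring R by fact
  show ?thesis
  proof (rule idealI[OF ring_axioms])
    show "subgroup (integral_closure R I) (add_monoid R)"
    proof (rule group.subgroupI[OF add.is_group])
      show "integral_closure R I \<subseteq> carrier (add_monoid R)" using integral_closure_carrier by auto
      obtain K where K: "ideal K R" "K \<subseteq> integral_closure R I"
        using integral_closure_directed[OF R I, of "{}"] by auto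
      then show "integral_closure R I \<noteq> {}"
        using additive_subgroup.zero_closed[OF ideal.axioms(1)[OF K(1)]] by blast
    next
      fix x assume "x \<in> integral_closure R I"
      then obtain K where K: "ideal K R" "x \<in> K" "K \<subseteq> integral_closure R I"
        using integral_closure_directed[OF R I, of "{x}"] by auto
      then show "inv\<^bsub>add_monoid R\<^esub> x \<in> integral_closure R I"
        using additive_subgroup.a_inv_closed[OF ideal.axioms(1)[OF K(1)] K(2)]
        unfolding a_inv_def[symmetric] by blast
    next
      fix x y assume "x \<in> integral_closure R I" "y \<in> integral_closure R I"
      then obtain K where K: "ideal K R" "x \<in> K" "y \<in> K" "K \<subseteq> integral_closure R I"
        using integral_closure_directed[OF R I, of "{x, y}"] by auto
      then show "x \<otimes>\<^bsub>add_monoid R\<^esub> y \<in> integral_closure R I"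
        using additive_subgroup.a_closed[OF ideal.axioms(1)[OF K(1)] K(2,3)] by auto
    qed
    fix x r assume *: "x \<in> integral_closure R I" "r \<in> carrier R"
    then obtain K where K: "ideal K R" "x \<in> K" "K \<subseteq> integral_closure R I"
      using integral_closure_directed[OF R I, of "{x}"] by auto
    then show "r \<otimes> x \<in> integral_closure R I" using ideal.I_l_closed[OF K(1,2) *(2)] by blast
    then show "x \<otimes> r \<in> integral_closure R I" using * integral_closure_carrier[OF *(1)] by (simp add: m_comm)
  qed
qed

text \<open>It suffices that \<open>x N \<subseteq> I N\<close> for finitely many generators \<open>x\<close> of the integral closure, because
  \<open>{x. x N \<subseteq> I N}\<close> is an ideal.\<close>

lemma (in noetherian_ring) integral_closure_common_multiplier:
  assumes R: "cring R" and I: "regular_ideal I R"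
  obtains N where "regular_ideal N R"
    "\<And>x y. \<lbrakk>x \<in> integral_closure R I; y \<in> N\<rbrakk> \<Longrightarrow> x \<otimes> y \<in> I \<cdot> N"
proof -
  interpret cring R by fact
  obtain S where S: "S \<subseteq> carrier R" "finite S" "integral_closure R I = Idl S"
    using finetely_gen[OF integral_closure_ideal[OF R I]] by blast
  have SI: "S \<subseteq> integral_closure R I" unfolding S(3) by (rule genideal_self[OF S(1)])
  obtain N where N: "regular_ideal N R" "\<forall>x \<in> S. \<forall>y \<in> N. x \<otimes> y \<in> I \<cdot> N"
    using integral_set_common_multiplier[OF I S(2) SI] by (elim exE conjE) (rule that)
  have id: "ideal I R" "ideal N R" using I N(1) by (simp_all add: regular_ideal_def)
  have "Idl S \<subseteq> {x \<in> carrier R. \<forall>y \<in> N. x \<otimes> y \<in> I \<cdot> N}"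
  proof (rule genideal_minimal)
    show "ideal {x \<in> carrier R. \<forall>y \<in> N. x \<otimes> y \<in> I \<cdot> N} R"
      by (intro ideal_multiplier ideal_prod_is_ideal id)
    show "S \<subseteq> {x \<in> carrier R. \<forall>y \<in> N. x \<otimes> y \<in> I \<cdot> N}" using N(2) S(1) by auto
  qed
  then show thesis unfolding S(3)[symmetric] by (intro that[OF N(1)]) auto
qed


section \<open>Rank one\<close>

lemma free_of_rank_1I:
  assumes N: "module Q N" and b: "b \<in> carrier N"
    and ex: "\<And>x. x \<in> carrier N \<Longrightarrow> \<exists>q \<in> carrier Q. x = q \<odot>\<^bsub>N\<^esub> b"
    and inj: "\<And>p q. \<lbrakk>p \<in> carrier Q; q \<in> carrier Q; p \<odot>\<^bsub>N\<^esub> b = q \<odot>\<^bsub>N\<^esub> b\<rbrakk> \<Longrightarrow> p = q"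
  shows "free_of_rank Q N 1"
proof -
  interpret module Q N by (rule N)
  have sum: "(\<Oplus>\<^bsub>N\<^esub>i \<in> {..<1::nat}. c i \<odot>\<^bsub>N\<^esub> b) = c 0 \<odot>\<^bsub>N\<^esub> b" if "c \<in> {..<1} \<rightarrow>\<^sub>E carrier Q" for c :: "nat \<Rightarrow> _"
  proof -
    have "c 0 \<odot>\<^bsub>N\<^esub> b \<in> carrier N" using that b by (intro smult_closed) auto
    then show ?thesis by (simp add: lessThan_Suc)
  qed
  have "\<exists>!c. c \<in> {..<1::nat} \<rightarrow>\<^sub>E carrier Q \<and> x = (\<Oplus>\<^bsub>N\<^esub>i \<in> {..<1}. c i \<odot>\<^bsub>N\<^esub> b)"
    if x: "x \<in> carrier N" for x
  proof -
    obtain q where q: "q \<in> carrier Q" "x = q \<odot>\<^bsub>N\<^esub> b" using ex[OF x] by blast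
    let ?c = "\<lambda>i \<in> {..<1::nat}. q"
    have c: "?c \<in> {..<1} \<rightarrow>\<^sub>E carrier Q" using q by auto
    show ?thesis
    proof (rule ex1I[of _ ?c])
      show "?c \<in> {..<1} \<rightarrow>\<^sub>E carrier Q \<and> x = (\<Oplus>\<^bsub>N\<^esub>i \<in> {..<1}. ?c i \<odot>\<^bsub>N\<^esub> b)"
        using c q sum[OF c] by simp
      fix c :: "nat \<Rightarrow> _"
      assume *: "c \<in> {..<1} \<rightarrow>\<^sub>E carrier Q \<and> x = (\<Oplus>\<^bsub>N\<^esub>i \<in> {..<1}. c i \<odot>\<^bsub>N\<^esub> b)"
      then have "c 0 \<odot>\<^bsub>N\<^esub> b = q \<odot>\<^bsub>N\<^esub> b" using sum[of c] q by simp
      moreover have "c 0 \<in> carrier Q" using * by auto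
      ultimately have "c 0 = q" using inj q(1) by blast
      then show "c = ?c" by (intro PiE_ext[OF conjunct1[OF *] c]) simp
    qed
  qed
  then show ?thesis unfolding free_of_rank_def using N b by (intro conjI bexI[of _ "\<lambda>_. b"]) auto
qed

context scalar_extension
begin

text \<open>A map \<open>g\<close> on \<open>M\<close> that is linear along \<open>\<phi>\<close> induces the map \<open>x \<otimes> q \<mapsto> g(x) q\<close> on the tensor product.
  It is given here on the free group, as a homomorphism vanishing on the kernel; it is what
  detects that an element of the tensor product is nonzero.\<close>

lemma tensor_eval:
  assumes g: "\<And>x. x \<in> carrier M \<Longrightarrow> g x \<in> carrier Q"
    and add: "\<And>x y. \<lbrakk>x \<in> carrier M; y \<in> carrier M\<rbrakk> \<Longrightarrow> g (x \<oplus>\<^bsub>M\<^esub> y) = g x \<oplus>\<^bsub>Q\<^esub> g y"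
    and smult: "\<And>a x. \<lbrakk>a \<in> carrier R; x \<in> carrier M\<rbrakk> \<Longrightarrow> g (a \<odot>\<^bsub>M\<^esub> x) = \<phi> a \<otimes>\<^bsub>Q\<^esub> g x"
  obtains h where "h \<in> hom F (add_monoid Q)"
    "\<And>x q. \<lbrakk>x \<in> carrier M; q \<in> carrier Q\<rbrakk> \<Longrightarrow> h (frag_of (x, q)) = g x \<otimes>\<^bsub>Q\<^esub> q"
    "\<And>k. k \<in> K \<Longrightarrow> h k = \<zero>\<^bsub>Q\<^esub>"
proof -
  have "(\<lambda>(x, q). g x \<otimes>\<^bsub>Q\<^esub> q) ` (carrier M \<times> carrier Q) \<subseteq> carrier (add_monoid Q)"
    using g by auto
  then obtain h where h: "h \<in> hom F (add_monoid Q)"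
    and gen: "\<And>z. z \<in> carrier M \<times> carrier Q \<Longrightarrow> h (frag_of z) = (\<lambda>(x, q). g x \<otimes>\<^bsub>Q\<^esub> q) z"
    unfolding tensor_free_def
    by (rule comm_group.free_Abelian_group_universal[OF Q.a_comm_group]) blast
  have hg: "h (frag_of (x, q)) = g x \<otimes>\<^bsub>Q\<^esub> q" if "x \<in> carrier M" "q \<in> carrier Q" for x q
    using gen[of "(x, q)"] that by simp
  interpret h: group_hom F "add_monoid Q" h
    by (intro group_hom.intro group_hom_axioms.intro F_group Q.a_group h)
  have h_add: "h (c + d) = h c \<oplus>\<^bsub>Q\<^esub> h d" if "c \<in> carrier F" "d \<in> carrier F" for c d
    using h.hom_mult[OF that] by simp
  have h_diff: "h (c - d) = \<zero>\<^bsub>Q\<^esub>" if "c \<in> carrier F" "d \<in> carrier F" "h c = h d" for c d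
  proof -
    have "h c = h (c - d) \<oplus>\<^bsub>Q\<^esub> h d" using h_add[of "c - d" d] that F_diff by simp
    moreover have "h (c - d) \<in> carrier Q" "h d \<in> carrier Q"
      using h.hom_closed that F_diff by auto
    ultimately show ?thesis using that(3) by (metis Q.add.r_cancel_one')
  qed
  note [simp] = hg h_add F_add F_frag_of hom_closed g add smult
  have "h c = \<zero>\<^bsub>Q\<^esub>" if c: "c \<in> tensor_relations R M Q \<phi>" for c
    using c unfolding tensor_relations_def
  proof (elim UnE CollectE exE conjE)
    fix x y q assume *: "x \<in> carrier M" "y \<in> carrier M" "q \<in> carrier Q"
      and c: "c = frag_of (x \<oplus>\<^bsub>M\<^esub> y, q) - (frag_of (x, q) + frag_of (y, q))"
    show ?thesis unfolding c using * by (intro h_diff) (simp_all add: Q.l_distr)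
  next
    fix x p q assume *: "x \<in> carrier M" "p \<in> carrier Q" "q \<in> carrier Q"
      and c: "c = frag_of (x, p \<oplus>\<^bsub>Q\<^esub> q) - (frag_of (x, p) + frag_of (x, q))"
    show ?thesis unfolding c using * by (intro h_diff) (simp_all add: Q.r_distr)
  next
    fix a x q assume *: "a \<in> carrier R" "x \<in> carrier M" "q \<in> carrier Q"
      and c: "c = frag_of (a \<odot>\<^bsub>M\<^esub> x, q) - frag_of (x, \<phi> a \<otimes>\<^bsub>Q\<^esub> q)"
    show ?thesis unfolding c using * by (intro h_diff) (simp_all add: Q.m_ac)
  qed
  then have "tensor_relations R M Q \<phi> \<subseteq> kernel F (add_monoid Q) h"
    using relations_F by (auto simp: kernel_def)
  then have "K \<subseteq> kernel F (add_monoid Q) h"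
    unfolding tensor_kernel_def
    by (rule group.generate_subgroup_incl[OF F_group _ h.subgroup_kernel])
  then have "h k = \<zero>\<^bsub>Q\<^esub>" if "k \<in> K" for k using that by (auto simp: kernel_def)
  then show thesis by (intro that[OF h]) (simp_all add: hg)
qed

text \<open>The basis is \<open>s \<otimes> 1\<close>. If \<open>r x = a s\<close> and \<open>\<phi>(r)\<close> is a unit, then
  \<open>x \<otimes> q = r x \<otimes> \<phi>(r)\<^sup>-\<^sup>1 q = s \<otimes> \<phi>(a) \<phi>(r)\<^sup>-\<^sup>1 q\<close>, so \<open>s \<otimes> 1\<close> generates. The linear form \<open>g\<close> sends
  \<open>s \<otimes> q\<close> to \<open>g(s) q\<close>, from which \<open>q\<close> is recovered.\<close>

lemma extend_scalars_rank_1: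
  assumes s: "s \<in> carrier M"
    and mult: "\<And>x. x \<in> carrier M \<Longrightarrow>
      \<exists>r \<in> carrier R. \<exists>a \<in> carrier R. \<phi> r \<in> Units Q \<and> r \<odot>\<^bsub>M\<^esub> x = a \<odot>\<^bsub>M\<^esub> s"
    and g: "\<And>x. x \<in> carrier M \<Longrightarrow> g x \<in> carrier Q"
    and add: "\<And>x y. \<lbrakk>x \<in> carrier M; y \<in> carrier M\<rbrakk> \<Longrightarrow> g (x \<oplus>\<^bsub>M\<^esub> y) = g x \<oplus>\<^bsub>Q\<^esub> g y"
    and smult: "\<And>a x. \<lbrakk>a \<in> carrier R; x \<in> carrier M\<rbrakk> \<Longrightarrow> g (a \<odot>\<^bsub>M\<^esub> x) = \<phi> a \<otimes>\<^bsub>Q\<^esub> g x"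
    and unit: "g s \<in> Units Q"
  shows "free_of_rank Q E 1"
proof (rule free_of_rank_1I[OF extend_scalars_module])
  let ?b = "K #>\<^bsub>F\<^esub> frag_of (s, \<one>\<^bsub>Q\<^esub>)"
  have b: "q \<odot>\<^bsub>E\<^esub> ?b = K #>\<^bsub>F\<^esub> frag_of (s, q)" if "q \<in> carrier Q" for q
    using that s by (simp add: E_smult F_frag_of)
  show "?b \<in> carrier E" using s by (simp add: E_simps F_frag_of)
  have span: "\<exists>q \<in> carrier Q. c - frag_of (s, q) \<in> K" if "c \<in> carrier F" for c
    using that
  proof (induction c rule: F_induct)
    case zero
    \<comment> \<open>The relation for \<open>0 + 0 = 0\<close> is \<open>- (s \<otimes> 0)\<close>.\<close>
    have "frag_of (s, \<zero>\<^bsub>Q\<^esub> \<oplus>\<^bsub>Q\<^esub> \<zero>\<^bsub>Q\<^esub>) - (frag_of (s, \<zero>\<^bsub>Q\<^esub>) + frag_of (s, \<zero>\<^bsub>Q\<^esub>)) \<in> K"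
      using s by (intro relation_K relation_add_right) auto
    then show ?case by (intro bexI[of _ "\<zero>\<^bsub>Q\<^esub>"]) simp_all
  next
    case (diff c d)
    then obtain p q where pq: "p \<in> carrier Q" "q \<in> carrier Q"
      and K: "c - frag_of (s, p) \<in> K" "d - frag_of (s, q) \<in> K" by blast
    have m: "p \<ominus>\<^bsub>Q\<^esub> q \<in> carrier Q" "(p \<ominus>\<^bsub>Q\<^esub> q) \<oplus>\<^bsub>Q\<^esub> q = p"
      using pq by (simp_all add: a_minus_def Q.a_assoc Q.l_neg)
    then have "frag_of (s, p) - (frag_of (s, p \<ominus>\<^bsub>Q\<^esub> q) + frag_of (s, q)) \<in> K"
      using relation_K[OF relation_add_right[OF s m(1) pq(2)]] by simp
    then have "((c - frag_of (s, p)) - (d - frag_of (s, q)))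
        + (frag_of (s, p) - (frag_of (s, p \<ominus>\<^bsub>Q\<^esub> q) + frag_of (s, q))) \<in> K"
      by (rule K_add[OF K_diff[OF K]])
    then have "(c - d) - frag_of (s, p \<ominus>\<^bsub>Q\<^esub> q) \<in> K" by (simp add: algebra_simps)
    then show ?case using m(1) by blast
  next
    case (gen x q)
    then obtain r a where ra: "r \<in> carrier R" "a \<in> carrier R" "\<phi> r \<in> Units Q"
      "r \<odot>\<^bsub>M\<^esub> x = a \<odot>\<^bsub>M\<^esub> s" using mult by blast
    define p where "p = inv\<^bsub>Q\<^esub> (\<phi> r) \<otimes>\<^bsub>Q\<^esub> q"
    have p: "p \<in> carrier Q" "\<phi> r \<otimes>\<^bsub>Q\<^esub> p = q"
      using ra(3) gen Q.Units_closed[OF ra(3)] by (simp_all add: p_def Q.m_assoc[symmetric])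
    have "frag_of (r \<odot>\<^bsub>M\<^esub> x, p) - frag_of (x, q) \<in> K"
      using relation_K[OF relation_smult[OF ra(1) gen(1) p(1)]] p(2) by simp
    moreover have "frag_of (a \<odot>\<^bsub>M\<^esub> s, p) - frag_of (s, \<phi> a \<otimes>\<^bsub>Q\<^esub> p) \<in> K"
      by (rule relation_K[OF relation_smult[OF ra(2) s p(1)]])
    ultimately have "(frag_of (a \<odot>\<^bsub>M\<^esub> s, p) - frag_of (s, \<phi> a \<otimes>\<^bsub>Q\<^esub> p))
        - (frag_of (r \<odot>\<^bsub>M\<^esub> x, p) - frag_of (x, q)) \<in> K"
      by (rule K_diff[rotated])
    then have "frag_of (x, q) - frag_of (s, \<phi> a \<otimes>\<^bsub>Q\<^esub> p) \<in> K" by (simp add: ra(4))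
    moreover have "\<phi> a \<otimes>\<^bsub>Q\<^esub> p \<in> carrier Q" using hom_closed[OF ra(2)] p(1) by simp
    ultimately show ?case by blast
  qed
  fix C assume "C \<in> carrier E"
  then obtain c where c: "c \<in> carrier F" "C = K #>\<^bsub>F\<^esub> c" by (auto simp: E_simps)
  obtain q where q: "q \<in> carrier Q" "c - frag_of (s, q) \<in> K" using span[OF c(1)] by blast
  have "C = q \<odot>\<^bsub>E\<^esub> ?b"
    unfolding b[OF q(1)] c(2) by (rule coset_eq[OF c(1) F_frag_of[OF s q(1)] q(2)])
  then show "\<exists>q \<in> carrier Q. C = q \<odot>\<^bsub>E\<^esub> ?b" using q(1) by blast
next
  let ?b = "K #>\<^bsub>F\<^esub> frag_of (s, \<one>\<^bsub>Q\<^esub>)"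
  fix p q assume pq: "p \<in> carrier Q" "q \<in> carrier Q" and eq: "p \<odot>\<^bsub>E\<^esub> ?b = q \<odot>\<^bsub>E\<^esub> ?b"
  obtain h where h: "h \<in> hom F (add_monoid Q)"
    "\<And>x q. \<lbrakk>x \<in> carrier M; q \<in> carrier Q\<rbrakk> \<Longrightarrow> h (frag_of (x, q)) = g x \<otimes>\<^bsub>Q\<^esub> q"
    "\<And>k. k \<in> K \<Longrightarrow> h k = \<zero>\<^bsub>Q\<^esub>"
    using tensor_eval[of g, OF g add smult] by blast
  have "K #>\<^bsub>F\<^esub> frag_of (s, p) = K #>\<^bsub>F\<^esub> frag_of (s, q)"
    using eq pq s by (simp add: E_smult F_frag_of)
  then have "frag_of (s, p) \<in> K #>\<^bsub>F\<^esub> frag_of (s, q)"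
    using group.rcos_self[OF F_group F_frag_of[OF s pq(1)] K_subgroup] by simp
  then obtain k where k: "k \<in> K" "frag_of (s, p) = k + frag_of (s, q)"
    by (auto simp: r_coset_def)
  have "h (k + frag_of (s, q)) = h k \<oplus>\<^bsub>Q\<^esub> h (frag_of (s, q))"
    using hom_mult[OF h(1) K_F[OF k(1)] F_frag_of[OF s pq(2)]] by simp
  then have "g s \<otimes>\<^bsub>Q\<^esub> p = g s \<otimes>\<^bsub>Q\<^esub> q"
    using h(3)[OF k(1)] h(2)[OF s] pq g[OF s] by (simp flip: k(2))
  then show "p = q" using Q.Units_l_cancel[OF unit pq] by simp
qed

end

section \<open>An ideal as a module\<close>

definition ideal_module :: "('a, 'b) ring_scheme \<Rightarrow> 'a set \<Rightarrow> ('a, 'a) module"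
  where "ideal_module R N = \<lparr>carrier = N, monoid.mult = (\<otimes>\<^bsub>R\<^esub>), one = \<one>\<^bsub>R\<^esub>,
    ring.zero = \<zero>\<^bsub>R\<^esub>, ring.add = (\<oplus>\<^bsub>R\<^esub>), smult = (\<otimes>\<^bsub>R\<^esub>)\<rparr>"

context cring
begin

lemma ideal_module_simps [simp]:
  "carrier (ideal_module R N) = N" "\<zero>\<^bsub>ideal_module R N\<^esub> = \<zero>"
  "u \<oplus>\<^bsub>ideal_module R N\<^esub> v = u \<oplus> v" "a \<odot>\<^bsub>ideal_module R N\<^esub> u = a \<otimes> u"
  by (simp_all add: ideal_module_def)

lemma ideal_module_is_module:
  assumes N: "ideal N R"
  shows "module R (ideal_module R N)"
proof -
  interpret N: ideal N R by (rule N)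
  note cl = N.Icarr
  show ?thesis
  proof (rule moduleI)
    show "cring R" by (rule is_cring)
    show "abelian_group (ideal_module R N)"
    proof (rule abelian_groupI)
      fix u assume "u \<in> carrier (ideal_module R N)"
      then show "\<exists>v \<in> carrier (ideal_module R N). v \<oplus>\<^bsub>ideal_module R N\<^esub> u = \<zero>\<^bsub>ideal_module R N\<^esub>"
        using cl by (intro bexI[of _ "\<ominus> u"]) (simp_all add: l_neg)
    qed (use cl in \<open>auto simp: a_ac\<close>)
  qed (use cl N.I_l_closed in \<open>auto simp: l_distr r_distr m_assoc\<close>)
qed

lemma submodule_ideal_module_iff:
  assumes N: "ideal N R"
  shows "submodule K R (ideal_module R N) \<longleftrightarrow> ideal K R \<and> K \<subseteq> N"
proof
  interpret M: module R "ideal_module R N" by (rule ideal_module_is_module[OF N])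
  assume K: "submodule K R (ideal_module R N)"
  note KE = M.submoduleE[OF K, simplified]
  have cl: "u \<in> carrier R" if "u \<in> K" for u using KE(1) that ideal.Icarr[OF N] by blast
  have "ideal K R"
  proof (rule idealI[OF ring_axioms])
    show "subgroup K (add_monoid R)"
    proof (rule group.subgroupI[OF add.is_group])
      show "K \<subseteq> carrier (add_monoid R)" using cl by auto
      show "K \<noteq> {}" by (rule KE(2))
      fix u v assume u: "u \<in> K"
      \<comment> \<open>Scaling by \<open>-1\<close> gives negatives in \<open>R\<close>, without comparing the two additive inverses.\<close>
      have "(\<ominus> \<one>) \<otimes> u \<in> K" using KE(4) u by simp
      then show "inv\<^bsub>add_monoid R\<^esub> u \<in> K" using cl[OF u] by (simp add: l_minus flip: a_inv_def)
      assume "v \<in> K"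
      then show "u \<otimes>\<^bsub>add_monoid R\<^esub> v \<in> K" using KE(5) u by simp
    qed
    fix u r assume "u \<in> K" "r \<in> carrier R"
    then show "r \<otimes> u \<in> K" "u \<otimes> r \<in> K" using KE(4) cl by (simp_all add: m_comm)
  qed
  then show "ideal K R \<and> K \<subseteq> N" using KE(1) by simp
next
  interpret M: module R "ideal_module R N" by (rule ideal_module_is_module[OF N])
  assume *: "ideal K R \<and> K \<subseteq> N"
  interpret K: ideal K R using * by simp
  show "submodule K R (ideal_module R N)"
  proof (rule M.submoduleI)
    fix u assume u: "u \<in> K"
    then have uN: "u \<in> N" "\<ominus> u \<in> N" using * by auto
    have "\<ominus>\<^bsub>ideal_module R N\<^esub> u = \<ominus> u"
      by (rule M.minus_equality) (use uN ideal.Icarr[OF N] in \<open>simp_all add: l_neg\<close>)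
    then show "\<ominus>\<^bsub>ideal_module R N\<^esub> u \<in> K" using u by simp
  qed (use * K.I_l_closed in auto)
qed

lemma module_span_ideal_module:
  assumes N: "ideal N R" and S: "S \<subseteq> N"
  shows "module_span R (ideal_module R N) S = Idl S"
proof -
  have Sc: "S \<subseteq> carrier R" using S ideal_subset_carrier[OF N] by blast
  have "ideal (Idl S) R \<and> Idl S \<subseteq> N" "S \<subseteq> Idl S"
    by (simp_all add: genideal_ideal genideal_self genideal_minimal N S Sc)
  then show ?thesis
    unfolding module_span_def submodule_ideal_module_iff[OF N]
    by (auto dest: genideal_minimal)
qed

lemma fin_gen_ideal_module:
  assumes "ideal N R" "finite S" "S \<subseteq> carrier R" "N = Idl S"
  shows "fin_gen_module R (ideal_module R N)"
proof -
  have "S \<subseteq> N" unfolding assms(4) by (rule genideal_self[OF assms(3)])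
  then show ?thesis
    unfolding fin_gen_module_def
    using assms ideal_module_is_module module_span_ideal_module[OF assms(1)] by auto
qed

lemma ideal_smult_ideal_module:
  assumes J: "ideal J R" and N: "ideal N R"
  shows "ideal_smult R (ideal_module R N) J = J \<cdot> N"
proof -
  have eq: "{a \<odot>\<^bsub>ideal_module R N\<^esub> u | a u. a \<in> J \<and> u \<in> carrier (ideal_module R N)} = J <#> N"
    by (auto simp: set_mult_def)
  have "J <#> N \<subseteq> N" using ideal.I_l_closed[OF N] ideal.Icarr[OF J] by (auto simp: set_mult_def)
  then show ?thesis
    unfolding ideal_smult_def eq by (simp add: module_span_ideal_module N ideal_prod_eq_genideal J)
qed

text \<open>Since \<open>I\<^sup>k\<^sup>+\<^sup>1 N = I (I\<^sup>k N)\<close>, the \<open>k\<close>-th colon ideal is the set of multipliers of \<open>I\<^sup>k N\<close> into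
  \<open>I (I\<^sup>k N)\<close>.\<close>

lemma r_ideal_ideal_module:
  assumes I: "ideal I R" and N: "ideal N R"
  shows "r_ideal R I (ideal_module R N) = (\<Union>k \<in> {1..}. {x \<in> carrier R.
    \<forall>y \<in> ideal_pow R I k \<cdot> N. x \<otimes> y \<in> I \<cdot> (ideal_pow R I k \<cdot> N)})"
proof -
  have "ideal_pow R I (k + 1) \<cdot> N = I \<cdot> (ideal_pow R I k \<cdot> N)" for k
    by (simp add: ideal_pow_Suc ideal_prod_commute[OF ideal_pow_ideal[OF I] I]
        ideal_prod_assoc I N ideal_pow_ideal)
  then show ?thesis
    unfolding r_ideal_def colon_def
    by (simp add: ideal_smult_ideal_module I N ideal_pow_ideal del: One_nat_def)
qed

lemma to_fractions_unit:
  assumes s: "s \<in> nonzerodivisors R"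
  shows "to_fractions R s \<in> Units (total_fractions R)"
proof -
  have sc: "s \<in> carrier R" using s by (rule nzd_carrier)
  have cl: "to_fractions R s \<in> carrier (total_fractions R)" "fraction R \<one> s \<in> carrier (total_fractions R)"
    using s sc by (simp_all add: to_fractions_def fraction_in_carrier)
  have "fraction R \<one> s \<otimes>\<^bsub>total_fractions R\<^esub> to_fractions R s = \<one>\<^bsub>total_fractions R\<^esub>"
    using s sc by (simp add: to_fractions_def total_fractions_mult total_fractions_carrier fraction_eq_iff)
  moreover have "to_fractions R s \<otimes>\<^bsub>total_fractions R\<^esub> fraction R \<one> s = \<one>\<^bsub>total_fractions R\<^esub>"
    using s sc by (simp add: to_fractions_def total_fractions_mult total_fractions_carrier fraction_eq_iff)
  ultimately show ?thesis using cl unfolding Units_def by blast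
qed

text \<open>With a nonzerodivisor \<open>s \<in> N\<close>, the relation \<open>s u = u s\<close>, read as a relation between the elements
  \<open>u\<close> and \<open>s\<close> of \<open>N\<close> with coefficients \<open>s\<close> and \<open>u\<close>, makes each \<open>u\<close> a fraction times \<open>s\<close>; the
  linear form is the restriction of \<open>R \<rightarrow> Q\<close>.\<close>

lemma regular_ideal_module_rank:
  assumes "regular_ideal N R"
  shows "has_rank R (ideal_module R N) 1"
proof -
  have N: "ideal N R" using assms by (simp add: regular_ideal_def)
  obtain s where s: "s \<in> N" "s \<in> nonzerodivisors R" using assms by (auto simp: regular_ideal_def)
  note cl = ideal.Icarr[OF N]
  interpret E: scalar_extension R "ideal_module R N" "total_fractions R" "to_fractions R"
    by (rule scalar_extension_total_fractions[OF ideal_module_is_module[OF N]])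
  show ?thesis
    unfolding has_rank_def
  proof (rule E.extend_scalars_rank_1[of s "to_fractions R"])
    fix u assume "u \<in> carrier (ideal_module R N)"
    then have u: "u \<in> carrier R" using cl by simp
    have "s \<odot>\<^bsub>ideal_module R N\<^esub> u = u \<odot>\<^bsub>ideal_module R N\<^esub> s"
      using u cl[OF s(1)] by (simp add: m_comm)
    then show "\<exists>r \<in> carrier R. \<exists>a \<in> carrier R. to_fractions R r \<in> Units (total_fractions R) \<and>
        r \<odot>\<^bsub>ideal_module R N\<^esub> u = a \<odot>\<^bsub>ideal_module R N\<^esub> s"
      using u cl[OF s(1)] to_fractions_unit[OF s(2)] by blast
  qed (use s cl to_fractions_unit[OF s(2)] E.hom_closed ring_hom_add[OF E.hom] ring_hom_mult[OF E.hom] in auto)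
qed

end

section \<open>A module with \<open>r(I, M)\<close> the integral closure\<close>

lemma (in noetherian_ring) exists_rank_one_module_r_ideal_eq:
  assumes R: "cring R" and I: "regular_ideal I R"
  obtains M :: "('a, 'a) module" where "fin_gen_module R M" "has_rank R M 1"
    "r_ideal R I M = integral_closure R I"
proof -
  interpret cring R by fact
  obtain N where N: "regular_ideal N R"
    and mult: "\<And>x y. \<lbrakk>x \<in> integral_closure R I; y \<in> N\<rbrakk> \<Longrightarrow> x \<otimes> y \<in> I \<cdot> N"
    by (rule integral_closure_common_multiplier[OF R I]) blast
  have id: "ideal I R" "ideal N R" using I N by (simp_all add: regular_ideal_def)
  obtain S where "S \<subseteq> carrier R" "finite S" "N = Idl S" using finetely_gen[OF id(2)] by blast
  then have fg: "fin_gen_module R (ideal_module R N)" by (intro fin_gen_ideal_module[of N S] id(2))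
  have "r_ideal R I (ideal_module R N) = integral_closure R I"
    unfolding r_ideal_ideal_module[OF id]
  proof (intro subset_antisym subsetI)
    fix x assume "x \<in> (\<Union>k \<in> {1..}. {x \<in> carrier R.
      \<forall>y \<in> ideal_pow R I k \<cdot> N. x \<otimes> y \<in> I \<cdot> (ideal_pow R I k \<cdot> N)})"
    then obtain k where "x \<in> carrier R"
      "\<And>y. y \<in> ideal_pow R I k \<cdot> N \<Longrightarrow> x \<otimes> y \<in> I \<cdot> (ideal_pow R I k \<cdot> N)" by blast
    then show "x \<in> integral_closure R I"
      by (rule regular_multiplier_integral[OF R id(1) regular_ideal_prod[OF regular_ideal_pow[OF I] N]])
  next
    fix x assume x: "x \<in> integral_closure R I"
    have "x \<otimes> y \<in> I \<cdot> (N \<cdot> I)" if "y \<in> N \<cdot> I" for y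
      by (rule multiplier_prod_left[OF id id(1) integral_closure_carrier[OF x] mult[OF x] that])
    then have "\<forall>y \<in> ideal_pow R I 1 \<cdot> N. x \<otimes> y \<in> I \<cdot> (ideal_pow R I 1 \<cdot> N)"
      by (simp add: ideal_pow_1 id ideal_prod_commute[OF id])
    then show "x \<in> (\<Union>k \<in> {1..}. {x \<in> carrier R.
      \<forall>y \<in> ideal_pow R I k \<cdot> N. x \<otimes> y \<in> I \<cdot> (ideal_pow R I k \<cdot> N)})"
      using integral_closure_carrier[OF x] by blast
  qed
  then show thesis using that fg regular_ideal_module_rank[OF N] by blast
qed

theorem theorem4p4:
  fixes R :: "('a, 'b) ring_scheme" and I :: "'a set"
  assumes "cring R" and "noetherian_ring R" and "regular_ideal I R"
  shows "(\<forall>J. ideal J R \<and> I \<subseteq> J \<and> J \<subseteq> integral_closure R I \<longrightarrow>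
            (\<exists>M :: ('a, 'a) module. fin_gen_module R M \<and> has_rank R M 1 \<and>
               I \<subseteq> J \<and> J \<subseteq> r_ideal R I M \<and> r_ideal R I M \<subseteq> integral_closure R I)) \<and>
         (\<exists>M :: ('a, 'a) module. fin_gen_module R M \<and> has_rank R M 1 \<and>
            r_ideal R I M = integral_closure R I)"
proof -
  obtain M :: "('a, 'a) module" where M: "fin_gen_module R M" "has_rank R M 1"
    "r_ideal R I M = integral_closure R I"
    by (rule noetherian_ring.exists_rank_one_module_r_ideal_eq[OF assms(2,1,3)])
  then show ?thesis by (intro conjI allI impI exI[of _ M]) simp_all
qed

end
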